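(* Let $X$ be a compact metric space, let $r:X\to X$ be a Borel measurable map which is onto and finite-to-one (i.e. $0<\#r^{-1}(x)<\infty$ for all $x\in X$), let $\mu$ be a strongly invariant measure on $X$, and let $m_0\in L^\infty(X)$ be a QMF filter. Suppose that $r:(X,\mu)\to(X,\mu)$ is ergodic, that $|m_0|$ is not constantly equal to $1$ $\mu$-a.e., that $\mu(\{x\in X : m_0(x)=0\})=0$, and that $\log|m_0|^2\in L^1(X)$. Let $(\mathcal{H},U,\pi,\varphi)$ be the wavelet representation associated to $m_0$. Then: (1) There exist solutions $\varphi'\in\mathcal{H}$ of the scaling equation $U\varphi'=\pi(m_0)\varphi'$ which are not constant multiples of $\varphi$. (2) There exist non-constant (i.e. not $\mu$-a.e. equal to a constant), bounded fixed points $f\in L^\infty(X)$, $R_{m_0}f=f$, of the transfer operator $$R_{m_0}f(x)=\frac{1}{\#r^{-1}(x)}\sum_{r(y)=x}|m_0(y)|^2f(y),\quad f\in L^\infty(X),\ x\in X.$$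
   Context: $L^p(X)$ denotes $L^p(X,\mu)$. A Borel measure $\mu$ on $X$ is strongly invariant (for $r$) if $$\int_X f\,d\mu=\int_X\frac{1}{\#r^{-1}(x)}\sum_{r(y)=x}f(y)\,d\mu(x)\quad\text{for all } f\in L^\infty(X)$$ (in particular constants are integrable, so $\mu$ is finite). A function $m_0\in L^\infty(X)$ is a QMF filter if $\frac{1}{\#r^{-1}(x)}\sum_{r(y)=x}|m_0(y)|^2=1$ for $\mu$-a.e. $x\in X$. The wavelet representation associated to $m_0$ is the quadruple $(\mathcal{H},U,\pi,\varphi)$ consisting of a Hilbert space $\mathcal{H}$, a unitary operator $U$ on $\mathcal{H}$, a ($*$-)representation $\pi$ of $L^\infty(X)$ on $\mathcal{H}$ and an element $\varphi\in\mathcal{H}$ such that: (1) (covariance) $U\pi(f)U^{-1}=\pi(f\circ r)$ for all $f\in L^\infty(X)$; (2) (scaling equation) $U\varphi=\pi(m_0)\varphi$; (3) (orthogonality) $\langle\pi(f)\varphi,\varphi\rangle=\int_X f\,d\mu$ for all $f\in L^\infty(X)$; (4) (density) $\{U^{-n}\pi(f)\varphi : n\in\mathbb{N},\ f\in L^\infty(X)\}$ is dense in $\mathcal{H}$. Such a quadruple is known to exist and to be unique up to isomorphism (unitary equivalence). *)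

theory Defs
  imports "HOL-Analysis.Analysis"
begin

text \<open>
  Complex Hilbert spaces. The inner product is linear in its first argument.
\<close>

class complex_hilbert_space = banach +
  fixes scaleC :: "complex \<Rightarrow> 'a \<Rightarrow> 'a"  (infixr \<open>*\<^sub>C\<close> 75)
    and cinner :: "'a \<Rightarrow> 'a \<Rightarrow> complex"
  assumes scaleC_add_right: "a *\<^sub>C (x + y) = a *\<^sub>C x + a *\<^sub>C y"
    and scaleC_add_left: "(a + b) *\<^sub>C x = a *\<^sub>C x + b *\<^sub>C x"
    and scaleC_scaleC: "a *\<^sub>C (b *\<^sub>C x) = (a * b) *\<^sub>C x"
    and scaleC_of_real: "complex_of_real s *\<^sub>C x = s *\<^sub>R x"
    and cinner_commute: "cinner x y = cnj (cinner y x)"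
    and cinner_add_left: "cinner (x + y) z = cinner x z + cinner y z"
    and cinner_scaleC_left: "cinner (a *\<^sub>C x) y = a * cinner x y"
    and cinner_self: "cinner x x = complex_of_real ((norm x)\<^sup>2)"

definition bounded_clinear :: "('h::complex_hilbert_space \<Rightarrow> 'h) \<Rightarrow> bool" where
  "bounded_clinear T \<longleftrightarrow> bounded_linear T \<and> (\<forall>c v. T (c *\<^sub>C v) = c *\<^sub>C T v)"

definition unitary_operator :: "('h::complex_hilbert_space \<Rightarrow> 'h) \<Rightarrow> bool" where
  "unitary_operator U \<longleftrightarrow>
     bounded_clinear U \<and> surj U \<and> (\<forall>v w. cinner (U v) (U w) = cinner v w)"

text \<open>
  Elements of \<open>L\<^sup>\<infinity>\<close> are represented by functions; equality in \<open>L\<^sup>\<infinity>\<close> is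
  equality almost everywhere.
\<close>

definition Linfty :: "'a measure \<Rightarrow> ('a \<Rightarrow> complex) set" where
  "Linfty M = {f \<in> borel_measurable M. \<exists>C. AE x in M. cmod (f x) \<le> C}"

definition fibre_mean :: "'a set \<Rightarrow> ('a \<Rightarrow> 'a) \<Rightarrow> ('a \<Rightarrow> 'b::field) \<Rightarrow> 'a \<Rightarrow> 'b" where
  "fibre_mean X r f x = 1 / of_nat (card (r -` {x} \<inter> X)) * (\<Sum>y \<in> r -` {x} \<inter> X. f y)"

text \<open>
  Using \<open>has_bochner_integral\<close> makes the existence of the right-hand integral part
  of the condition, rather than letting it default to 0. The measurability this
  includes is automatic for a finite-to-one Borel map of a compact metric space
  (Lusin--Novikov).
\<close>

definition strongly_invariant :: "('a \<Rightarrow> 'a) \<Rightarrow> 'a measure \<Rightarrow> bool" where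
  "strongly_invariant r M \<longleftrightarrow> finite_measure M \<and>
     (\<forall>f \<in> Linfty M. has_bochner_integral M (fibre_mean (space M) r f) (\<integral>x. f x \<partial>M))"

definition ergodic :: "('a \<Rightarrow> 'a) \<Rightarrow> 'a measure \<Rightarrow> bool" where
  "ergodic r M \<longleftrightarrow>
     (\<forall>A \<in> sets M. r -` A \<inter> space M = A \<longrightarrow>
        emeasure M A = 0 \<or> emeasure M (space M - A) = 0)"

definition qmf_filter :: "('a \<Rightarrow> 'a) \<Rightarrow> 'a measure \<Rightarrow> ('a \<Rightarrow> complex) \<Rightarrow> bool" where
  "qmf_filter r M m0 \<longleftrightarrow> m0 \<in> Linfty M \<and>
     (AE x in M. fibre_mean (space M) r (\<lambda>y. (cmod (m0 y))\<^sup>2) x = 1)"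

definition transfer_operator ::
  "'a set \<Rightarrow> ('a \<Rightarrow> 'a) \<Rightarrow> ('a \<Rightarrow> complex) \<Rightarrow> ('a \<Rightarrow> complex) \<Rightarrow> 'a \<Rightarrow> complex" where
  "transfer_operator X r m0 f = fibre_mean X r (\<lambda>y. complex_of_real ((cmod (m0 y))\<^sup>2) * f y)"

text \<open>
  The first condition says that \<open>\<pi>\<close> is well defined on \<open>L\<^sup>\<infinity>\<close>, the last one that
  \<open>\<pi> (cnj \<circ> f)\<close> is the adjoint of \<open>\<pi> f\<close>. Values of \<open>\<pi>\<close> outside \<open>Linfty M\<close> are irrelevant.
\<close>

definition star_representation ::
  "'a measure \<Rightarrow> (('a \<Rightarrow> complex) \<Rightarrow> 'h::complex_hilbert_space \<Rightarrow> 'h) \<Rightarrow> bool" where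
  "star_representation M \<pi> \<longleftrightarrow>
     (\<forall>f \<in> Linfty M. \<forall>g \<in> Linfty M. (AE x in M. f x = g x) \<longrightarrow> \<pi> f = \<pi> g) \<and>
     (\<forall>f \<in> Linfty M. bounded_clinear (\<pi> f)) \<and>
     (\<forall>f \<in> Linfty M. \<forall>g \<in> Linfty M. \<forall>v. \<pi> (\<lambda>x. f x + g x) v = \<pi> f v + \<pi> g v) \<and>
     (\<forall>f \<in> Linfty M. \<forall>c v. \<pi> (\<lambda>x. c * f x) v = c *\<^sub>C \<pi> f v) \<and>
     (\<forall>f \<in> Linfty M. \<forall>g \<in> Linfty M. \<forall>v. \<pi> (\<lambda>x. f x * g x) v = \<pi> f (\<pi> g v)) \<and>
     (\<forall>f \<in> Linfty M. \<forall>v w. cinner (\<pi> (\<lambda>x. cnj (f x)) v) w = cinner v (\<pi> f w))"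

text \<open>
  Density together with covariance forces \<open>\<pi>\<close> to be unital, so this is not demanded.
\<close>

definition wavelet_representation ::
  "('a \<Rightarrow> 'a) \<Rightarrow> 'a measure \<Rightarrow> ('a \<Rightarrow> complex) \<Rightarrow> ('h \<Rightarrow> 'h) \<Rightarrow>
   (('a \<Rightarrow> complex) \<Rightarrow> 'h \<Rightarrow> 'h) \<Rightarrow> 'h::complex_hilbert_space \<Rightarrow> bool" where
  "wavelet_representation r M m0 U \<pi> \<phi> \<longleftrightarrow>
     unitary_operator U \<and> star_representation M \<pi> \<and>
     (\<forall>f \<in> Linfty M. U \<circ> \<pi> f \<circ> inv U = \<pi> (f \<circ> r)) \<and>
     U \<phi> = \<pi> m0 \<phi> \<and>
     (\<forall>f \<in> Linfty M. cinner (\<pi> f \<phi>) \<phi> = (\<integral>x. f x \<partial>M)) \<and>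
     closure {(inv U ^^ n) (\<pi> f \<phi>) | n f. f \<in> Linfty M} = UNIV"

end

theory Submission
  imports Defs
begin

text \<open>
  Write \<open>D = |m0|\<^sup>2\<close>, let \<open>T\<close> be the transfer operator and \<open>wt n = D \<cdot> (D \<circ> r) \<cdots> (D \<circ> r\<^sup>n\<^sup>-\<^sup>1)\<close>,
  so that \<open>\<integral> T\<^sup>n f = \<integral> wt n \<cdot> f\<close>. Since \<open>ln t \<le> t - 1\<close>, the integral of \<open>ln D\<close> is negative, and by
  ergodicity \<open>wt n\<close> decays exponentially almost everywhere; hence \<open>S = \<Sum>n. wt n\<close> is finite.
  For \<open>0 \<le> f \<le> 1\<close> the weighted orbit average \<open>g = (\<Sum>n. wt n \<cdot> f \<circ> r\<^sup>n) / S\<close> satisfies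
  \<open>|g - g \<circ> r| \<le> 1 / S\<close>, and \<open>\<Sum>n. \<integral> T\<^sup>n (1 / S) = \<integral> S / S\<close> is finite. So \<open>T\<^sup>n g\<close> converges almost
  everywhere to a bounded fixed point \<open>h\<close> with \<open>\<integral> h = \<integral> f\<close> and \<open>h \<ge> f \<cdot> w\<close>, where
  \<open>w = (1 - \<Sum>n\<ge>1. T\<^sup>n (1 / S)) / S\<close> is positive on a set of positive measure. If all the fixed
  points obtained from indicator functions of sets \<open>B\<close> were constant, then \<open>\<mu>(B) \<ge> \<mu>(X) \<cdot> w\<close> on \<open>B\<close>,
  which is impossible for small \<open>B\<close> unless \<open>\<mu>\<close> has a point mass; and a point mass
  contradicts the finiteness of \<open>S\<close>. A bounded fixed point \<open>h\<close> gives the solution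
  \<open>lim U\<^sup>-\<^sup>n \<pi>(h) U\<^sup>n \<phi>\<close> of the scaling equation, a limit of a bounded martingale.
\<close>

section \<open>Ergodic finite-to-one maps\<close>

definition ess_bounded :: "'a measure \<Rightarrow> ('a \<Rightarrow> real) \<Rightarrow> bool" where
  "ess_bounded M f \<longleftrightarrow> f \<in> borel_measurable M \<and> (\<exists>C. AE x in M. \<bar>f x\<bar> \<le> C)"

lemma ess_boundedI:
  "f \<in> borel_measurable M \<Longrightarrow> AE x in M. \<bar>f x\<bar> \<le> C \<Longrightarrow> ess_bounded M f"
  by (auto simp: ess_bounded_def)

lemma ess_bounded_measurable: "ess_bounded M f \<Longrightarrow> f \<in> borel_measurable M"
  by (auto simp: ess_bounded_def)

lemma ess_bounded_const [simp]: "ess_bounded M (\<lambda>x. c)"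
  by (auto simp: ess_bounded_def)

lemma ess_bounded_add [intro]:
  assumes "ess_bounded M f" "ess_bounded M g"
  shows "ess_bounded M (\<lambda>x. f x + g x)"
proof -
  obtain A B where "AE x in M. \<bar>f x\<bar> \<le> A" "AE x in M. \<bar>g x\<bar> \<le> B"
    using assms by (auto simp: ess_bounded_def)
  then have "AE x in M. \<bar>f x + g x\<bar> \<le> A + B"
    by eventually_elim linarith
  with assms show ?thesis by (auto simp: ess_bounded_def)
qed

lemma ess_bounded_mult [intro]:
  assumes "ess_bounded M f" "ess_bounded M g"
  shows "ess_bounded M (\<lambda>x. f x * g x)"
proof -
  obtain A B where "AE x in M. \<bar>f x\<bar> \<le> A" "AE x in M. \<bar>g x\<bar> \<le> B"
    using assms by (auto simp: ess_bounded_def)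
  then have "AE x in M. \<bar>f x * g x\<bar> \<le> A * B"
    by eventually_elim (simp add: abs_mult mult_mono')
  with assms show ?thesis by (auto simp: ess_bounded_def)
qed

lemma ess_bounded_diff [intro]:
  assumes "ess_bounded M f" "ess_bounded M g"
  shows "ess_bounded M (\<lambda>x. f x - g x)"
  using ess_bounded_add[OF assms(1) ess_bounded_mult[OF ess_bounded_const[of M "-1"] assms(2)]]
  by simp

lemma ess_bounded_power [intro]:
  "ess_bounded M f \<Longrightarrow> ess_bounded M (\<lambda>x. f x ^ n)"
  by (induction n) auto

lemma ess_bounded_sum [intro]:
  "(\<And>i. i \<in> I \<Longrightarrow> ess_bounded M (f i)) \<Longrightarrow> ess_bounded M (\<lambda>x. \<Sum>i\<in>I. f i x)"
  by (induction I rule: infinite_finite_induct) auto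

lemma ess_bounded_indicator: "A \<in> sets M \<Longrightarrow> ess_bounded M (indicator A)"
  by (rule ess_boundedI[where C=1]) (auto simp: indicator_def)

lemma (in finite_measure) ess_bounded_integrable: "ess_bounded M f \<Longrightarrow> integrable M f"
  unfolding ess_bounded_def by (auto intro!: integrable_const_bound)

section \<open>Strongly invariant measures and ergodicity\<close>

locale fibred = finite_measure M for M :: "'a measure" +
  fixes r :: "'a \<Rightarrow> 'a"
  assumes r_measurable [measurable]: "r \<in> measurable M M"
    and r_onto: "r ` space M = space M"
    and finite_fibre: "x \<in> space M \<Longrightarrow> finite (r -` {x} \<inter> space M)"
    and mean: "ess_bounded M f \<Longrightarrow>
      has_bochner_integral M (fibre_mean (space M) r f) (\<integral>x. f x \<partial>M)"
begin

abbreviation "fibre x \<equiv> r -` {x} \<inter> space M"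

lemma r_space: "x \<in> space M \<Longrightarrow> r x \<in> space M"
  using r_onto by auto

lemma rn_space: "x \<in> space M \<Longrightarrow> (r ^^ n) x \<in> space M"
  by (induction n) (auto simp: r_space)

lemma card_fibre_pos: "x \<in> space M \<Longrightarrow> card (fibre x) > 0"
proof -
  assume x: "x \<in> space M"
  then obtain y where "y \<in> space M" "x = r y" using r_onto by blast
  then show ?thesis using finite_fibre[OF x] by (auto simp: card_gt_0_iff)
qed

lemma fibre_mean_comp:
  assumes "x \<in> space M"
  shows "fibre_mean (space M) r (\<lambda>y. f (r y)) x = (f x :: 'b::field_char_0)"
proof -
  have "(\<Sum>y\<in>fibre x. f (r y)) = (\<Sum>y\<in>fibre x. f x)"
    by (rule sum.cong) auto
  then show ?thesis
    using card_fibre_pos[OF assms] by (simp add: fibre_mean_def)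
qed

text \<open>The indicator of a null set has integral 0, so its fibre mean vanishes almost
  everywhere, and a mean of nonnegative numbers over a finite fibre vanishes only if every term
  does. Through this lemma \<open>T\<close> respects order and equality almost everywhere.\<close>

lemma AE_fibre:
  assumes "AE x in M. P x"
  shows "AE x in M. \<forall>y\<in>fibre x. P y"
proof -
  obtain N where N: "N \<in> null_sets M" "{x\<in>space M. \<not> P x} \<subseteq> N"
    using assms unfolding eventually_ae_filter by auto
  let ?i = "indicator N :: 'a \<Rightarrow> real"
  have hb: "has_bochner_integral M (fibre_mean (space M) r ?i) 0"
    using mean[OF ess_bounded_indicator[OF null_setsD2[OF N(1)]]] N(1)
    by (simp add: null_setsD1 null_setsD2 measure_def)
  have "AE x in M. fibre_mean (space M) r ?i x = 0"
    using hb by (subst integral_nonneg_eq_0_iff_AE[symmetric])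
      (auto simp: has_bochner_integral_iff fibre_mean_def sum_nonneg)
  then show ?thesis
  proof (rule AE_mp, intro AE_I2 impI ballI)
    fix x y assume x: "x \<in> space M" and *: "fibre_mean (space M) r ?i x = 0"
      and y: "y \<in> fibre x"
    have "(\<Sum>y\<in>fibre x. ?i y) = 0"
      using * card_fibre_pos[OF x] finite_fibre[OF x] by (auto simp: fibre_mean_def)
    then have "?i y = 0"
      using y finite_fibre[OF x] by (subst (asm) sum_nonneg_eq_0_iff) auto
    then show "P y" using N(2) y by (auto simp: indicator_def split: if_splits)
  qed
qed

text \<open>The indicator of the preimage of \<open>A\<close> is constant on fibres with fibre mean
  \<open>indicator A\<close>, so strong invariance contains ordinary invariance.\<close>

lemma distr_r: "distr M M r = M"
proof (rule measure_eqI)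
  fix A assume "A \<in> sets (distr M M r)"
  then have A [measurable]: "A \<in> sets M" by simp
  let ?B = "r -` A \<inter> space M"
  have B: "?B \<in> sets M" by measurable
  have "measure M ?B = (\<integral>x. fibre_mean (space M) r (indicator ?B) x \<partial>M)"
    using mean[OF ess_bounded_indicator[OF B]] B by (simp add: has_bochner_integral_iff)
  also have "\<dots> = (\<integral>x. indicator A x \<partial>M)"
  proof (rule Bochner_Integration.integral_cong[OF refl])
    fix x assume x: "x \<in> space M"
    have "fibre_mean (space M) r (indicator ?B) x
        = fibre_mean (space M) r (\<lambda>y. indicator A (r y) :: real) x"
      unfolding fibre_mean_def
      by (intro arg_cong2[where f="(*)"] refl sum.cong) (auto simp: indicator_def)
    also have "\<dots> = indicator A x" by (rule fibre_mean_comp[OF x])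
    finally show "fibre_mean (space M) r (indicator ?B) x = (indicator A x :: real)" .
  qed
  finally have "measure M ?B = measure M A" by simp
  then show "emeasure (distr M M r) A = emeasure M A"
    by (simp add: emeasure_distr emeasure_eq_measure)
qed simp

lemma AE_r: "AE x in M. P x \<Longrightarrow> AE x in M. P (r x)"
  by (rule AE_distrD[OF r_measurable]) (simp only: distr_r)

lemma AE_rn: "AE x in M. P x \<Longrightarrow> AE x in M. P ((r ^^ n) x)"
proof (induction n arbitrary: P)
  case (Suc n)
  show ?case using AE_r[OF Suc.IH[OF Suc.prems]] by (simp add: funpow_swap1)
qed simp

lemma rn_measurable [measurable]: "(r ^^ n) \<in> measurable M M"
  by (rule measurable_compose_n[OF r_measurable])

lemma integral_r: "f \<in> borel_measurable M \<Longrightarrow> (\<integral>x. f (r x) \<partial>M) = (\<integral>x. f x \<partial>M :: real)"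
  using integral_distr[of r M M f] by (simp add: distr_r)

lemma integrable_r: "integrable M (f :: 'a \<Rightarrow> real) \<Longrightarrow> integrable M (\<lambda>x. f (r x))"
  using integrable_distr[of r M M f] by (simp add: distr_r)

lemma ess_bounded_rn: "ess_bounded M f \<Longrightarrow> ess_bounded M (\<lambda>x. f ((r ^^ n) x))"
  unfolding ess_bounded_def using AE_rn by fastforce

lemma ess_bounded_r: "ess_bounded M f \<Longrightarrow> ess_bounded M (\<lambda>x. f (r x))"
  using ess_bounded_rn[of f 1] by simp

text \<open>If the Birkhoff sums of \<open>\<phi>\<close> were unbounded above, then \<open>birk_max (Suc n) - birk_max n \<circ> r\<close>
  would decrease to \<open>\<phi>\<close>, although its integral is nonnegative.\<close>

primrec birk_max :: "('a \<Rightarrow> real) \<Rightarrow> nat \<Rightarrow> 'a \<Rightarrow> real" where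
  "birk_max \<phi> 0 = (\<lambda>x. 0)"
| "birk_max \<phi> (Suc n) = (\<lambda>x. max 0 (\<phi> x + birk_max \<phi> n (r x)))"

lemma birk_max_nonneg: "0 \<le> birk_max \<phi> n x"
  by (cases n) auto

lemma birk_max_Suc: "birk_max \<phi> n x \<le> birk_max \<phi> (Suc n) x"
proof (induction n arbitrary: x)
  case (Suc n)
  have "birk_max \<phi> n (r x) \<le> birk_max \<phi> (Suc n) (r x)" by (rule Suc.IH)
  then show ?case by auto
qed simp

lemma birk_max_integrable: "integrable M \<phi> \<Longrightarrow> integrable M (birk_max \<phi> n)"
proof (induction n)
  case (Suc n)
  then have "integrable M (\<lambda>x. birk_max \<phi> n (r x))" by (intro integrable_r)
  with Suc.prems show ?case by (auto intro!: integrable_max)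
qed simp

lemma ergodic_bdd_above:
  assumes erg: "ergodic r M" and \<phi>: "integrable M \<phi>" and neg: "(\<integral>x. \<phi> x \<partial>M) < 0"
  shows "AE x in M. bdd_above (range (\<lambda>n. birk_max \<phi> n x))"
proof -
  define A where "A = {x\<in>space M. \<not> bdd_above (range (\<lambda>n. birk_max \<phi> n x))}"
  note [measurable] = borel_measurable_integrable[OF \<phi>]
    borel_measurable_integrable[OF birk_max_integrable[OF \<phi>]]
  have A_alt: "A = {x\<in>space M. \<forall>k::nat. \<exists>n. birk_max \<phi> n x > real k}"
  proof -
    have "bdd_above (range (\<lambda>n. birk_max \<phi> n x)) \<longleftrightarrow> (\<exists>k::nat. \<forall>n. birk_max \<phi> n x \<le> real k)" for x
      proof
      assume "bdd_above (range (\<lambda>n. birk_max \<phi> n x))"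
      then obtain K where K: "birk_max \<phi> n x \<le> K" for n by (auto simp: bdd_above_def)
      obtain k where "K \<le> real k" using real_arch_simple by blast
      then show "\<exists>k::nat. \<forall>n. birk_max \<phi> n x \<le> real k" using K order_trans by blast
    qed (auto simp: bdd_above_def)
    then show ?thesis by (auto simp: A_def not_le)
  qed
  have A_sets: "A \<in> sets M" unfolding A_alt by measurable
  have bdd_r: "bdd_above (range (\<lambda>n. birk_max \<phi> n (r x))) \<longleftrightarrow>
               bdd_above (range (\<lambda>n. birk_max \<phi> n x))" for x
  proof
    assume "bdd_above (range (\<lambda>n. birk_max \<phi> n (r x)))"
    then obtain K where K: "\<And>n. birk_max \<phi> n (r x) \<le> K" by (auto simp: bdd_above_def)
    have "birk_max \<phi> n x \<le> max 0 (\<phi> x + K)" for n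
      using K[of "n - 1"] by (cases n) auto
    then show "bdd_above (range (\<lambda>n. birk_max \<phi> n x))" by (auto simp: bdd_above_def)
  next
    assume "bdd_above (range (\<lambda>n. birk_max \<phi> n x))"
    then obtain K where K: "\<And>n. birk_max \<phi> n x \<le> K" by (auto simp: bdd_above_def)
    have "birk_max \<phi> n (r x) \<le> K - \<phi> x" for n
      using K[of "Suc n"] by auto
    then show "bdd_above (range (\<lambda>n. birk_max \<phi> n (r x)))" by (auto simp: bdd_above_def)
  qed
  \<comment> \<open>\<open>ergodic\<close> speaks of strictly invariant sets, so boundedness at
    \<open>x\<close> and at \<open>r x\<close> must be equivalent at every point, without an
    exceptional null set.\<close>
  have "r -` A \<inter> space M = A"
  proof (rule set_eqI)
    fix x show "x \<in> r -` A \<inter> space M \<longleftrightarrow> x \<in> A"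
      by (cases "x \<in> space M")
        (simp_all only: A_def vimage_eq Int_iff mem_Collect_eq bdd_r r_space simp_thms)
  qed
  then consider "emeasure M A = 0" | "emeasure M (space M - A) = 0"
    using erg A_sets by (auto simp: ergodic_def)
  then show ?thesis
  proof cases
    case 1
    then have "A \<in> null_sets M" using A_sets by auto
    then show ?thesis
      by (rule AE_I') (auto simp: A_def)
  next
    case 2
    then have "space M - A \<in> null_sets M" using A_sets by auto
    then have AE_A: "AE x in M. x \<in> A"
      by (rule AE_I') auto
    \<comment> \<open>\<open>birk_max \<phi> n\<close> is the largest Birkhoff sum of length at most
      \<open>n\<close>, the empty sum included. The difference \<open>d n x\<close> is
      \<open>\<phi> x\<close> as soon as some sum from \<open>r x\<close> exceeds
      \<open>- \<phi> x\<close>.\<close>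
    define d where "d n x = birk_max \<phi> (Suc n) x - birk_max \<phi> n (r x)" for n x
    have d_eq: "d n x = max (\<phi> x) (- birk_max \<phi> n (r x))" for n x
      by (auto simp: d_def max_def)
    have meas: "d n \<in> borel_measurable M" for n unfolding d_def by measurable
    have lim: "(\<lambda>n. \<integral>x. d n x \<partial>M) \<longlonglongrightarrow> (\<integral>x. \<phi> x \<partial>M)"
    proof (rule integral_dominated_convergence[where w="\<lambda>x. \<bar>\<phi> x\<bar>"])
      show "AE x in M. (\<lambda>n. d n x) \<longlonglongrightarrow> \<phi> x"
        using AE_A
      proof (rule AE_mp, intro AE_I2 impI)
        fix x assume "x \<in> A"
        then have "\<not> bdd_above (range (\<lambda>n. birk_max \<phi> n (r x)))"
          using bdd_r by (auto simp: A_def)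
        then obtain N where N: "birk_max \<phi> N (r x) > - \<phi> x"
          by (meson bdd_aboveI2 not_le)
        have "mono (\<lambda>n. birk_max \<phi> n (r x))"
          by (intro incseq_SucI birk_max_Suc)
        then have "birk_max \<phi> n (r x) > - \<phi> x" if "n \<ge> N" for n
          using that N unfolding mono_def by (meson less_le_trans)
        then have "eventually (\<lambda>n. d n x = \<phi> x) sequentially"
          unfolding eventually_sequentially d_eq by (intro exI[of _ N]) force
        then show "(\<lambda>n. d n x) \<longlonglongrightarrow> \<phi> x" by (rule tendsto_eventually)
      qed
      show "AE x in M. norm (d n x) \<le> \<bar>\<phi> x\<bar>" for n
      proof (rule AE_I2)
        fix x show "norm (d n x) \<le> \<bar>\<phi> x\<bar>"
          using birk_max_nonneg[of \<phi> n "r x"] unfolding d_eq real_norm_def by linarith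
      qed
    qed (use \<phi> meas in auto)
    \<comment> \<open>Invariance of the measure replaces \<open>r x\<close> by \<open>x\<close> in
      the second integral, and \<open>birk_max\<close> increases with \<open>n\<close>.\<close>
    have "0 \<le> (\<integral>x. d n x \<partial>M)" for n
    proof -
      have "(\<integral>x. d n x \<partial>M) = (\<integral>x. birk_max \<phi> (Suc n) x \<partial>M) - (\<integral>x. birk_max \<phi> n (r x) \<partial>M)"
        unfolding d_def
        by (intro Bochner_Integration.integral_diff birk_max_integrable integrable_r \<phi>)
      also have "\<dots> = (\<integral>x. birk_max \<phi> (Suc n) x - birk_max \<phi> n x \<partial>M)"
        by (subst Bochner_Integration.integral_diff[OF birk_max_integrable birk_max_integrable])
          (simp_all only: \<phi> integral_r borel_measurable_integrable birk_max_integrable)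
      also have "\<dots> \<ge> 0"
        by (intro Bochner_Integration.integral_nonneg) (simp only: diff_ge_0_iff_ge birk_max_Suc)
      finally show ?thesis .
    qed
    then have "0 \<le> (\<integral>x. \<phi> x \<partial>M)"
      using lim by (intro LIMSEQ_le_const[OF lim]) auto
    with neg show ?thesis by simp
  qed
qed

end

section \<open>The transfer operator\<close>

lemma (in finite_measure) measure_space_pos:
  assumes "\<not> (AE x in M. P x)"
  shows "measure M (space M) > 0"
proof (rule ccontr)
  assume "\<not> measure M (space M) > 0"
  then have "space M \<in> null_sets M"
    by (auto simp: emeasure_eq_measure zero_less_measure_iff)
  then have "AE x in M. P x" by (rule AE_I') auto
  with assms show False by simp
qed

locale transfer = fibred M r for M :: "'a measure" and r +
  fixes D :: "'a \<Rightarrow> real"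
  assumes D_bounded: "ess_bounded M D"
    and D_nonneg: "0 \<le> D x"
    and D_pos: "AE x in M. D x > 0"
    and D_mean: "AE x in M. fibre_mean (space M) r D x = 1"
begin

definition T :: "('a \<Rightarrow> real) \<Rightarrow> 'a \<Rightarrow> real" where
  "T f = fibre_mean (space M) r (\<lambda>y. D y * f y)"

primrec wt :: "nat \<Rightarrow> 'a \<Rightarrow> real" where
  "wt 0 = (\<lambda>x. 1)"
| "wt (Suc n) = (\<lambda>x. D x * wt n (r x))"

lemma wt_nonneg: "0 \<le> wt n x"
  by (induction n arbitrary: x) (auto simp: D_nonneg)

lemma wt_bounded: "ess_bounded M (wt n)"
  by (induction n) (auto intro!: D_bounded ess_bounded_r)

lemma wt_add: "wt (m + k) x = wt k x * wt m ((r ^^ k) x)"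
  by (induction k arbitrary: x) (simp_all add: funpow_swap1)

lemma T_cong: "(\<And>y. y \<in> space M \<Longrightarrow> f y = g y) \<Longrightarrow> T f x = T g x"
  by (auto simp: T_def fibre_mean_def intro!: sum.cong)

lemma T_add: "T (\<lambda>y. f y + g y) x = T f x + T g x"
  by (simp add: T_def fibre_mean_def algebra_simps sum.distrib)

lemma T_cmult: "T (\<lambda>y. c * f y) x = c * T f x"
  by (simp add: T_def fibre_mean_def algebra_simps sum_distrib_left)

lemma T_diff: "T (\<lambda>y. f y - g y) x = T f x - T g x"
  using T_add[of f "\<lambda>y. (-1) * g y" x] T_cmult[of "-1" g x] by simp

text \<open>On the fibre over \<open>x\<close> the factor \<open>g (r y)\<close> has the single
  value \<open>g x\<close>. This is the pull-out rule of a conditional expectation.\<close>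

lemma T_comp: "x \<in> space M \<Longrightarrow> T (\<lambda>y. f y * g (r y)) x = g x * T f x"
  by (auto simp: T_def fibre_mean_def sum_distrib_left mult_ac intro!: sum.cong)

lemma T_mono_point: "(\<And>y. y \<in> fibre x \<Longrightarrow> f y \<le> g y) \<Longrightarrow> T f x \<le> T g x"
  by (auto simp: T_def fibre_mean_def D_nonneg intro!: divide_right_mono sum_mono mult_left_mono)

lemma T_one: "AE x in M. T (\<lambda>y. c) x = c"
  using D_mean
proof eventually_elim
  case (elim x)
  then have "T (\<lambda>y. 1) x = 1" by (simp add: T_def)
  then show ?case using T_cmult[of c "\<lambda>y. 1" x] by simp
qed

lemma T_mono: "AE x in M. f x \<le> g x \<Longrightarrow> AE x in M. T f x \<le> T g x"
  by (drule AE_fibre, elim AE_mp) (auto intro!: AE_I2 T_mono_point)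

text \<open>Constants are fixed by \<open>T\<close> because of \<open>D_mean\<close>, so
  monotonicity keeps \<open>T f\<close> within the bounds of \<open>f\<close>. Measurability comes
  with \<open>has_bochner_integral\<close> in \<open>mean\<close>.\<close>

lemma T_bounded: assumes "ess_bounded M f" shows "ess_bounded M (T f)"
proof -
  obtain C where C: "AE x in M. \<bar>f x\<bar> \<le> C" using assms by (auto simp: ess_bounded_def)
  have "AE x in M. f x \<le> C" "AE x in M. - C \<le> f x" using C by auto
  then have "AE x in M. T f x \<le> T (\<lambda>y. C) x" "AE x in M. T (\<lambda>y. - C) x \<le> T f x"
    by (simp_all only: T_mono)
  moreover have "AE x in M. T (\<lambda>y. C) x = C" "AE x in M. T (\<lambda>y. - C) x = - C" by (rule T_one)+
  ultimately have "AE x in M. \<bar>T f x\<bar> \<le> C" by eventually_elim auto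
  moreover have "T f \<in> borel_measurable M"
    unfolding T_def
    using mean[OF ess_bounded_mult[OF D_bounded assms]]
    by (auto simp: has_bochner_integral_iff)
  ultimately show ?thesis by (rule ess_boundedI[rotated])
qed

lemma integral_T:
  assumes "ess_bounded M f"
  shows "(\<integral>x. T f x \<partial>M) = (\<integral>x. D x * f x \<partial>M)"
  using mean[OF ess_bounded_mult[OF D_bounded assms]]
  by (simp add: T_def has_bochner_integral_iff)

lemma Tn_diff: "(T ^^ n) (\<lambda>y. f y - g y) = (\<lambda>x. (T ^^ n) f x - (T ^^ n) g x)"
  by (induction n) (auto simp: T_diff)

lemma Tn_bounded: "ess_bounded M f \<Longrightarrow> ess_bounded M ((T ^^ n) f)"
  by (induction n) (auto intro!: T_bounded)

lemma Tn_mono: "AE x in M. f x \<le> g x \<Longrightarrow> AE x in M. (T ^^ n) f x \<le> (T ^^ n) g x"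
  by (induction n) (auto intro!: T_mono)

lemma Tn_const: "AE x in M. (T ^^ n) (\<lambda>y. c) x = c"
proof (induction n)
  case (Suc n)
  then have "AE x in M. (T ^^ n) (\<lambda>y. c) x \<le> c" "AE x in M. c \<le> (T ^^ n) (\<lambda>y. c) x" by auto
  from T_mono[OF this(1)] T_mono[OF this(2)] T_one[of c] show ?case
    by eventually_elim simp
qed simp

lemma Tn_abs_le:
  assumes "AE x in M. \<bar>f x\<bar> \<le> g x"
  shows "AE x in M. \<bar>(T ^^ n) f x\<bar> \<le> (T ^^ n) g x"
proof -
  have neg: "(T ^^ n) (\<lambda>y. - g y) x = - (T ^^ n) g x" for x
  proof (induction n arbitrary: x)
    case (Suc n)
    have eq: "(T ^^ n) (\<lambda>y. - g y) = (\<lambda>y. (-1) * (T ^^ n) g y)" using Suc by auto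
    show ?case by (simp add: eq T_cmult[of "-1", simplified])
  qed simp
  have "AE x in M. f x \<le> g x" "AE x in M. - g x \<le> f x" using assms by auto
  from Tn_mono[OF this(1), of n] Tn_mono[OF this(2), of n] show ?thesis
    by eventually_elim (simp add: neg abs_le_iff)
qed

lemma Tn_AE_cong:
  assumes "AE x in M. f x = g x"
  shows "AE x in M. (T ^^ n) f x = (T ^^ n) g x"
proof -
  have "AE x in M. f x \<le> g x" "AE x in M. g x \<le> f x" using assms by auto
  from Tn_mono[OF this(1), of n] Tn_mono[OF this(2), of n] show ?thesis
    by eventually_elim simp
qed

lemma Tn_nonneg:
  "AE x in M. 0 \<le> f x \<Longrightarrow> AE x in M. 0 \<le> (T ^^ n) f x"
  using Tn_mono[of "\<lambda>_. 0" f n] Tn_const[of n 0] by auto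

lemma T_tendsto:
  "(\<And>y. y \<in> fibre x \<Longrightarrow> (\<lambda>n. a n y) \<longlonglongrightarrow> b y) \<Longrightarrow> (\<lambda>n. T (a n) x) \<longlonglongrightarrow> T b x"
  unfolding T_def fibre_mean_def by (intro tendsto_intros) auto

lemma Tn_comp:
  "x \<in> space M \<Longrightarrow> (T ^^ n) (\<lambda>y. f y * g ((r ^^ n) y)) x = g x * (T ^^ n) f x"
proof (induction n arbitrary: g x)
  case (Suc n)
  have "(T ^^ Suc n) (\<lambda>y. f y * g ((r ^^ Suc n) y)) x
      = T (\<lambda>z. (T ^^ n) f z * g (r z)) x"
    using Suc.IH[of _ "\<lambda>z. g (r z)"] by (auto intro!: T_cong)
  also have "\<dots> = g x * (T ^^ Suc n) f x" using T_comp[OF Suc.prems] by simp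
  finally show ?case .
qed simp

text \<open>By \<open>T_comp\<close>, \<open>wt n x * T f x\<close> is \<open>T\<close> of
  \<open>wt n (r y) * f y\<close>; integrating with \<open>integral_T\<close> supplies the factor
  \<open>D\<close>, and \<open>D y * wt n (r y)\<close> is \<open>wt (Suc n) y\<close>.\<close>

lemma integral_Tn:
  "ess_bounded M f \<Longrightarrow> (\<integral>x. (T ^^ n) f x \<partial>M) = (\<integral>x. wt n x * f x \<partial>M)"
proof (induction n arbitrary: f)
  case (Suc n)
  have b: "ess_bounded M (\<lambda>x. wt n (r x) * f x)"
    by (intro ess_bounded_mult ess_bounded_r wt_bounded Suc.prems)
  have "(\<integral>x. (T ^^ Suc n) f x \<partial>M) = (\<integral>x. wt n x * T f x \<partial>M)"
    using Suc.IH[OF T_bounded[OF Suc.prems]] by (simp add: funpow_swap1)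
  also have "\<dots> = (\<integral>x. T (\<lambda>y. wt n (r y) * f y) x \<partial>M)"
    using T_comp[of _ f "wt n"]
    by (intro Bochner_Integration.integral_cong) (auto simp: mult.commute)
  also have "\<dots> = (\<integral>x. wt (Suc n) x * f x \<partial>M)"
    by (subst integral_T[OF b]) (simp add: mult_ac)
  finally show ?case .
qed simp

section \<open>Logarithmic mean and decay of the weights\<close>

lemma integral_D: "(\<integral>x. D x \<partial>M) = measure M (space M)"
proof -
  have "(\<integral>x. D x \<partial>M) = (\<integral>x. T (\<lambda>_. 1) x \<partial>M)"
    using integral_T[of "\<lambda>_. 1"] by simp
  also have "\<dots> = (\<integral>x. 1 \<partial>M)"
    using T_one[of 1] T_bounded[of "\<lambda>_. 1"]
    by (intro integral_cong_AE) (auto simp: ess_bounded_measurable)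
  finally show ?thesis by simp
qed

text \<open>\<open>D - 1 - ln D\<close> is nonnegative where \<open>D\<close> is positive, vanishes
  there only at \<open>D = 1\<close>, and has integral minus that of \<open>ln D\<close> by
  \<open>integral_D\<close>.\<close>

lemma integral_ln_neg:
  assumes int: "integrable M (\<lambda>x. ln (D x))" and "\<not> (AE x in M. D x = 1)"
  shows "(\<integral>x. ln (D x) \<partial>M) < 0"
proof -
  have D: "integrable M D" by (rule ess_bounded_integrable[OF D_bounded])
  have nn: "AE x in M. 0 \<le> D x - 1 - ln (D x)"
    using D_pos by eventually_elim (use ln_le_minus_one in force)
  have eq: "(\<integral>x. D x - 1 - ln (D x) \<partial>M) = - (\<integral>x. ln (D x) \<partial>M)"
    using int D by (simp add: integral_D)
  have "(\<integral>x. D x - 1 - ln (D x) \<partial>M) \<noteq> 0"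
  proof
    assume "(\<integral>x. D x - 1 - ln (D x) \<partial>M) = 0"
    then have "AE x in M. D x - 1 - ln (D x) = 0"
      using int D nn by (subst (asm) integral_nonneg_eq_0_iff_AE) auto
    with D_pos have "AE x in M. D x = 1"
      by eventually_elim (auto intro!: ln_eq_minus_one)
    with assms(2) show False by simp
  qed
  moreover have "(\<integral>x. D x - 1 - ln (D x) \<partial>M) \<ge> 0"
    by (rule Bochner_Integration.integral_nonneg_AE[OF nn])
  ultimately show ?thesis using eq by linarith
qed

lemma AE_orbit_pos: "AE x in M. \<forall>n. D ((r ^^ n) x) > 0"
  unfolding AE_all_countable using AE_rn[OF D_pos] by blast

lemma AE_summable_wt:
  assumes erg: "ergodic r M" and int: "integrable M (\<lambda>x. ln (D x))"
    and ne: "\<not> (AE x in M. D x = 1)"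
  shows "AE x in M. summable (\<lambda>n. wt n x)"
proof -
  let ?m = "measure M (space M)"
  have m: "?m > 0" by (rule measure_space_pos[OF ne])
  \<comment> \<open>Half of the average of \<open>- ln D\<close>: adding it to \<open>ln D\<close>
    keeps the integral negative and leaves \<open>\<delta>\<close> as the rate of exponential
    decay.\<close>
  define \<delta> where "\<delta> = - (\<integral>x. ln (D x) \<partial>M) / (2 * ?m)"
  have neg: "(\<integral>x. ln (D x) \<partial>M) < 0" by (rule integral_ln_neg[OF int ne])
  have \<delta>: "\<delta> > 0" unfolding \<delta>_def using m neg by (simp add: divide_neg_pos)
  define \<phi> where "\<phi> x = ln (D x) + \<delta>" for x
  have \<phi>: "integrable M \<phi>" unfolding \<phi>_def using int by simp
  have "(\<integral>x. \<phi> x \<partial>M) = (\<integral>x. ln (D x) \<partial>M) + \<delta> * ?m"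
    unfolding \<phi>_def using int by simp
  also have "\<dots> < 0" using m neg by (simp add: \<delta>_def)
  finally have "AE x in M. bdd_above (range (\<lambda>n. birk_max \<phi> n x))"
    by (rule ergodic_bdd_above[OF erg \<phi>])
  with AE_orbit_pos show ?thesis
  proof eventually_elim
    case (elim x)
    obtain K where K: "birk_max \<phi> n x \<le> K" for n
      using elim(2) by (auto simp: bdd_above_def)
    \<comment> \<open>Along an orbit where \<open>D\<close> is positive, \<open>wt n\<close> is the
      exponential of the Birkhoff sum of \<open>ln D\<close>, that is, of the sum of
      \<open>\<phi>\<close> minus \<open>\<delta> * n\<close>.\<close>
    have *: "wt n y \<le> exp (birk_max \<phi> n y - \<delta> * real n)" if "\<forall>n. D ((r ^^ n) y) > 0" for n y
      using that
    proof (induction n arbitrary: y)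
      case (Suc n)
      have D: "D y > 0" using Suc.prems[rule_format, of 0] by simp
      have pos: "\<forall>n. D ((r ^^ n) (r y)) > 0"
        using Suc.prems[rule_format, of "Suc n" for n] by (auto simp: funpow_swap1)
      have "wt (Suc n) y \<le> exp (ln (D y)) * exp (birk_max \<phi> n (r y) - \<delta> * real n)"
        using Suc.IH[OF pos] D by simp
      also have "\<dots> = exp (\<phi> y + birk_max \<phi> n (r y) - \<delta> * real (Suc n))"
        unfolding \<phi>_def by (simp add: exp_add[symmetric] algebra_simps del: exp_ln)
      also have "\<dots> \<le> exp (birk_max \<phi> (Suc n) y - \<delta> * real (Suc n))" by simp
      finally show ?case .
    qed simp
    have "wt n x \<le> exp K * exp (- \<delta>) ^ n" for n
    proof -
      have "wt n x \<le> exp (K - \<delta> * real n)"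
        using *[OF elim(1), of n] K[of n] by (meson diff_right_mono exp_le_cancel_iff order_trans)
      also have "\<dots> = exp K * exp (- \<delta>) ^ n"
        by (simp add: exp_diff exp_minus exp_of_nat_mult[symmetric] mult.commute divide_inverse
            power_inverse)
      finally show ?thesis .
    qed
    then show ?case
      using \<delta> wt_nonneg
      by (intro summable_comparison_test'[OF summable_mult[OF summable_geometric]]) auto
  qed
qed

text \<open>For a fixed point \<open>u\<close>, the sequence \<open>u ((r ^^ n) x)\<close> is a martingale read backwards,
  so its increments are orthogonal.\<close>

lemma harmonic_increment:
  assumes u: "ess_bounded M u" and fixed: "AE x in M. T u x = u x"
  shows "(\<integral>x. wt (m + k) x * (u x - u ((r ^^ k) x))\<^sup>2 \<partial>M)
       = (\<integral>x. wt (m + k) x * (u x)\<^sup>2 \<partial>M) - (\<integral>x. wt m x * (u x)\<^sup>2 \<partial>M)"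
proof -
  note [intro] = ess_bounded_rn[OF u, of k] wt_bounded u
  have Tk: "AE x in M. (T ^^ k) u x = u x"
  proof (induction k)
    case (Suc k)
    have "AE x in M. (T ^^ k) u x \<le> u x" "AE x in M. u x \<le> (T ^^ k) u x" using Suc by auto
    from T_mono[OF this(1)] T_mono[OF this(2)] fixed show ?case by eventually_elim simp
  qed simp
  \<comment> \<open>After splitting the weight with \<open>wt_add\<close>,
    \<open>integral_Tn\<close> turns \<open>wt k\<close> into \<open>T ^^ k\<close>, out of which
    the factors composed with \<open>r ^^ k\<close> are pulled.\<close>
  have red: "(\<integral>x. wt (m + k) x * (f x * g ((r ^^ k) x)) \<partial>M) = (\<integral>x. wt m x * (g x * (T ^^ k) f x) \<partial>M)"
    if f: "ess_bounded M f" and g: "ess_bounded M g" for f g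
  proof -
    have "(\<integral>x. wt (m + k) x * (f x * g ((r ^^ k) x)) \<partial>M)
        = (\<integral>x. wt k x * (f x * (wt m ((r ^^ k) x) * g ((r ^^ k) x))) \<partial>M)"
      by (simp add: wt_add mult_ac)
    also have "\<dots> = (\<integral>x. (T ^^ k) (\<lambda>x. f x * (wt m ((r ^^ k) x) * g ((r ^^ k) x))) x \<partial>M)"
      using f ess_bounded_rn[OF wt_bounded, of m k] ess_bounded_rn[OF g, of k]
      by (intro integral_Tn[symmetric] ess_bounded_mult)
    also have "\<dots> = (\<integral>x. wt m x * (g x * (T ^^ k) f x) \<partial>M)"
      using Tn_comp[of _ k f "\<lambda>x. wt m x * g x"]
      by (intro Bochner_Integration.integral_cong) (auto simp: mult_ac)
    finally show ?thesis .
  qed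
  have c1: "(\<integral>x. wt (m + k) x * (u x * u ((r ^^ k) x)) \<partial>M) = (\<integral>x. wt m x * (u x)\<^sup>2 \<partial>M)"
    unfolding red[OF u u]
  proof (rule integral_cong_AE)
    show "AE x in M. wt m x * (u x * (T ^^ k) u x) = wt m x * (u x)\<^sup>2"
      using Tk by eventually_elim (simp add: power2_eq_square)
  qed (auto intro!: ess_bounded_measurable ess_bounded_mult Tn_bounded)
  have c2: "(\<integral>x. wt (m + k) x * (1 * (u ((r ^^ k) x))\<^sup>2) \<partial>M) = (\<integral>x. wt m x * (u x)\<^sup>2 \<partial>M)"
    unfolding red[OF ess_bounded_const ess_bounded_power[OF u]]
  proof (rule integral_cong_AE)
    show "AE x in M. wt m x * ((u x)\<^sup>2 * (T ^^ k) (\<lambda>_. 1) x) = wt m x * (u x)\<^sup>2"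
      using Tn_const[of k 1] by eventually_elim simp
  qed (auto intro!: ess_bounded_measurable ess_bounded_mult Tn_bounded)
  have "(\<integral>x. wt (m + k) x * (u x - u ((r ^^ k) x))\<^sup>2 \<partial>M) =
    (\<integral>x. wt (m + k) x * (u x)\<^sup>2 - 2 * (wt (m + k) x * (u x * u ((r ^^ k) x)))
       + wt (m + k) x * (1 * (u ((r ^^ k) x))\<^sup>2) \<partial>M)"
    by (intro Bochner_Integration.integral_cong) (auto simp: power2_eq_square algebra_simps)
  also have "\<dots> = (\<integral>x. wt (m + k) x * (u x)\<^sup>2 \<partial>M)
    - 2 * (\<integral>x. wt (m + k) x * (u x * u ((r ^^ k) x)) \<partial>M)
    + (\<integral>x. wt (m + k) x * (1 * (u ((r ^^ k) x))\<^sup>2) \<partial>M)"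
  proof -
    have "integrable M (\<lambda>x. wt (m + k) x * (u x)\<^sup>2)"
      "integrable M (\<lambda>x. wt (m + k) x * (u x * u ((r ^^ k) x)))"
      "integrable M (\<lambda>x. wt (m + k) x * (1 * (u ((r ^^ k) x))\<^sup>2))"
      by (auto intro!: ess_bounded_integrable ess_bounded_mult)
    then show ?thesis by simp
  qed
  finally show ?thesis using c1 c2 by simp
qed

end

section \<open>Fixed points from weighted orbit averages\<close>

lemma unit_rangeD: "range f \<subseteq> {0..1::real} \<Longrightarrow> 0 \<le> f y" "range f \<subseteq> {0..1::real} \<Longrightarrow> f y \<le> 1"
  by (auto simp: image_subset_iff)

locale transient = transfer +
  assumes AE_summable: "AE x in M. summable (\<lambda>n. wt n x)"
begin

section \<open>Weighted orbit averages and their near-invariance\<close>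

definition S :: "'a \<Rightarrow> real" where
  "S x = (\<Sum>n. wt n x)"

definition avg :: "('a \<Rightarrow> real) \<Rightarrow> 'a \<Rightarrow> real" where
  "avg f x = (\<Sum>n. wt n x * f ((r ^^ n) x)) / S x"

lemma wt_measurable [measurable]: "wt n \<in> borel_measurable M"
  by (rule ess_bounded_measurable[OF wt_bounded])

lemma S_measurable [measurable]: "S \<in> borel_measurable M"
  unfolding S_def by measurable

lemma avg_measurable [measurable]:
  assumes f: "f \<in> borel_measurable M"
  shows "avg f \<in> borel_measurable M"
proof -
  note [measurable] = measurable_compose[OF rn_measurable f]
  show ?thesis unfolding avg_def by measurable
qed

lemma suminf_shift:
  assumes "summable (\<lambda>n. wt n (r x) * f ((r ^^ n) (r x)))"
  shows "summable (\<lambda>n. wt n x * f ((r ^^ n) x))"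
    and "(\<Sum>n. wt n x * f ((r ^^ n) x)) = f x + D x * (\<Sum>n. wt n (r x) * f ((r ^^ n) (r x)))"
proof -
  have eq: "wt (Suc n) x * f ((r ^^ Suc n) x) = D x * (wt n (r x) * f ((r ^^ n) (r x)))" for n
    by (simp add: funpow_swap1)
  have "summable (\<lambda>n. wt (Suc n) x * f ((r ^^ Suc n) x))"
    unfolding eq by (intro summable_mult assms)
  then show *: "summable (\<lambda>n. wt n x * f ((r ^^ n) x))" by (subst (asm) summable_Suc_iff)
  show "(\<Sum>n. wt n x * f ((r ^^ n) x)) = f x + D x * (\<Sum>n. wt n (r x) * f ((r ^^ n) (r x)))"
    unfolding suminf_split_head[OF *, simplified eq, symmetric]
    using suminf_split_head[OF *] suminf_mult[OF assms, of "D x"]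
    by (simp add: funpow_swap1 mult.assoc)
qed

lemma S_ge_sum: "summable (\<lambda>n. wt n x) \<Longrightarrow> (\<Sum>j<n. wt j x) \<le> S x"
  unfolding S_def by (intro sum_le_suminf) (auto simp: wt_nonneg)

lemma S_ge_1: "summable (\<lambda>n. wt n x) \<Longrightarrow> 1 \<le> S x"
  using S_ge_sum[of x 1] by simp

lemma S_Suc: "summable (\<lambda>n. wt n (r x)) \<Longrightarrow> S x = 1 + D x * S (r x)"
  using suminf_shift(2)[of x "\<lambda>_. 1"] by (simp add: S_def)

lemma AE_S: "AE x in M. 1 \<le> S x \<and> 1 \<le> S (r x) \<and> S x = 1 + D x * S (r x)"
  using AE_summable AE_r[OF AE_summable]
  by eventually_elim (use S_ge_1 S_Suc in blast)

lemma inv_S_bounded: "ess_bounded M (\<lambda>x. 1 / S x)"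
  using AE_S by (intro ess_boundedI[where C=1]) auto

lemma summable_wt_mult:
  assumes "summable (\<lambda>n. wt n x)" and f: "range f \<subseteq> {0..1::real}"
  shows "summable (\<lambda>n. wt n x * f ((r ^^ n) x))"
  by (rule summable_comparison_test'[OF assms(1)])
    (simp add: wt_nonneg unit_rangeD[OF f] mult_left_le)

lemma avg_bounds:
  assumes "range f \<subseteq> {0..1}"
  shows "AE x in M. 0 \<le> avg f x \<and> avg f x \<le> 1"
  using AE_summable
proof eventually_elim
  case (elim x)
  note s = summable_wt_mult[OF elim assms] and f = unit_rangeD[OF assms]
  have "(\<Sum>n. wt n x * f ((r ^^ n) x)) \<le> S x"
    unfolding S_def by (rule suminf_le[OF _ s elim]) (simp add: wt_nonneg f mult_left_le)
  moreover have "0 \<le> (\<Sum>n. wt n x * f ((r ^^ n) x))"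
    by (rule suminf_nonneg[OF s]) (simp add: wt_nonneg f)
  ultimately show ?case using S_ge_1[OF elim] by (auto simp: avg_def)
qed

lemma avg_bounded:
  assumes "f \<in> borel_measurable M" "range f \<subseteq> {0..1}"
  shows "ess_bounded M (avg f)"
  using avg_bounds[of f] assms by (intro ess_boundedI[where C=1]) auto

text \<open>\<open>suminf_shift\<close> gives a recursion for \<open>S x * avg f x\<close> in which
  the coefficient of \<open>avg f (r x)\<close> is \<open>D x * S (r x)\<close>, and this equals
  \<open>S x - 1\<close>. Division by \<open>S x\<close> leaves the claim.\<close>

lemma avg_diff:
  assumes "range f \<subseteq> {0..1}"
  shows "AE x in M. avg f x - avg f (r x) = (f x - avg f (r x)) / S x"
  using AE_S AE_r[OF AE_summable]
proof eventually_elim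
  case (elim x)
  have "S x * avg f x = f x + D x * (S (r x) * avg f (r x))"
    using suminf_shift(2)[OF summable_wt_mult[OF elim(2) assms]] elim(1) by (simp add: avg_def)
  also have "\<dots> = f x + (S x - 1) * avg f (r x)"
    using elim(1) by simp
  finally show ?case using elim(1) by (simp add: field_simps)
qed

lemma avg_diff_le:
  assumes "range f \<subseteq> {0..1}"
  shows "AE x in M. \<bar>avg f x - avg f (r x)\<bar> \<le> 1 / S x"
  using avg_diff[OF assms] AE_S AE_r[OF avg_bounds[OF assms]]
proof eventually_elim
  case (elim x)
  have "\<bar>f x - avg f (r x)\<bar> \<le> 1" using elim(3) unit_rangeD[OF assms, of x] by linarith
  then show ?case unfolding elim(1) using elim(2) by (simp add: abs_divide divide_right_mono)
qed

text \<open>The Green function \<open>\<Sum>n. T ^^ n\<close> applied to \<open>1 / S\<close> has integral \<open>\<Sum>n. \<integral> wt n / S = \<integral> 1\<close>.\<close>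

definition green :: "'a \<Rightarrow> real" where
  "green x = (\<Sum>j. (T ^^ Suc j) (\<lambda>y. 1 / S y) x)"

lemma Tn_inv_S_nonneg: "AE x in M. \<forall>j. 0 \<le> (T ^^ j) (\<lambda>y. 1 / S y) x"
  unfolding AE_all_countable using AE_S by (intro allI Tn_nonneg) auto

lemma Tn_inv_S_measurable [measurable]: "(T ^^ j) (\<lambda>y. 1 / S y) \<in> borel_measurable M"
  by (rule ess_bounded_measurable[OF Tn_bounded[OF inv_S_bounded]])

text \<open>The sum begins with the first power of \<open>T\<close>, so the weights that occur add
  up to at most \<open>S - 1\<close> and not \<open>S\<close>. The gap \<open>1 / S\<close> is what
  later keeps \<open>green\<close> below 1 somewhere. Extended values are used because summability
  is only deduced from this bound.\<close>

lemma nn_integral_green: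
  "(\<integral>\<^sup>+x. (\<Sum>j. ennreal ((T ^^ Suc j) (\<lambda>y. 1 / S y) x)) \<partial>M) \<le> ennreal (\<integral>x. 1 - 1 / S x \<partial>M)"
proof -
  have b: "ess_bounded M (\<lambda>x. wt j x * (1 / S x))" for j
    by (intro ess_bounded_mult wt_bounded inv_S_bounded)
  note i = ess_bounded_integrable[OF b]
  have "(\<integral>\<^sup>+x. (\<Sum>j. ennreal ((T ^^ Suc j) (\<lambda>y. 1 / S y) x)) \<partial>M)
      = (\<Sum>j. \<integral>\<^sup>+x. ennreal ((T ^^ Suc j) (\<lambda>y. 1 / S y) x) \<partial>M)"
    by (rule nn_integral_suminf) (simp del: funpow.simps)
  also have "\<dots> = (\<Sum>j. ennreal (\<integral>x. wt (Suc j) x * (1 / S x) \<partial>M))"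
  proof (rule suminf_cong)
    fix j
    have "(\<integral>\<^sup>+x. ennreal ((T ^^ Suc j) (\<lambda>y. 1 / S y) x) \<partial>M)
        = ennreal (\<integral>x. (T ^^ Suc j) (\<lambda>y. 1 / S y) x \<partial>M)"
    proof (intro nn_integral_eq_integral ess_bounded_integrable Tn_bounded inv_S_bounded)
      show "AE x in M. 0 \<le> (T ^^ Suc j) (\<lambda>y. 1 / S y) x"
        using Tn_inv_S_nonneg by (rule eventually_mono) blast
    qed
    then show "(\<integral>\<^sup>+x. ennreal ((T ^^ Suc j) (\<lambda>y. 1 / S y) x) \<partial>M)
        = ennreal (\<integral>x. wt (Suc j) x * (1 / S x) \<partial>M)"
      by (simp only: integral_Tn[OF inv_S_bounded])
  qed
  also have "\<dots> \<le> ennreal (\<integral>x. 1 - 1 / S x \<partial>M)"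
    unfolding suminf_eq_SUP
  proof (rule SUP_least)
    fix n
    have nn: "0 \<le> (\<integral>x. wt (Suc j) x * (1 / S x) \<partial>M)" for j
      using AE_S by (intro Bochner_Integration.integral_nonneg_AE)
        (auto simp: wt_nonneg simp del: wt.simps)
    have "(\<Sum>j<n. ennreal (\<integral>x. wt (Suc j) x * (1 / S x) \<partial>M))
        = ennreal (\<integral>x. (\<Sum>j<n. wt (Suc j) x * (1 / S x)) \<partial>M)"
      using i nn by (simp add: sum_ennreal del: wt.simps)
    also have "\<dots> \<le> ennreal (\<integral>x. 1 - 1 / S x \<partial>M)"
    proof (intro ennreal_leI integral_mono_AE)
      show "AE x in M. (\<Sum>j<n. wt (Suc j) x * (1 / S x)) \<le> 1 - 1 / S x"
        using AE_summable
      proof eventually_elim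
        case (elim x)
        have "1 + (\<Sum>j<n. wt (Suc j) x) \<le> S x"
          using S_ge_sum[OF elim, of "Suc n"] by (subst (asm) sum.lessThan_Suc_shift) simp
        then show ?case
          using S_ge_1[OF elim] unfolding sum_distrib_right[symmetric] by (simp add: field_simps)
      qed
    qed (use i ess_bounded_integrable[OF inv_S_bounded] in \<open>auto simp del: wt.simps\<close>)
    finally show "(\<Sum>j<n. ennreal (\<integral>x. wt (Suc j) x * (1 / S x) \<partial>M)) \<le> \<dots>" .
  qed
  finally show ?thesis .
qed

lemma AE_summable_green: "AE x in M. summable (\<lambda>j. (T ^^ Suc j) (\<lambda>y. 1 / S y) x)"
proof -
  have "AE x in M. (\<Sum>j. ennreal ((T ^^ Suc j) (\<lambda>y. 1 / S y) x)) \<noteq> \<infinity>"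
    using nn_integral_green
    by (intro nn_integral_noteq_infinite) (auto simp del: funpow.simps simp: top_unique)
  then show ?thesis
    using Tn_inv_S_nonneg
    by eventually_elim (auto intro!: summable_suminf_not_top simp del: funpow.simps)
qed

text \<open>Otherwise \<open>nn_integral_green\<close> would bound the total mass by itself minus
  the integral of \<open>1 / S\<close>, although \<open>1 / S\<close> is positive almost
  everywhere.\<close>

lemma not_AE_green_ge_1:
  assumes "measure M (space M) > 0"
  shows "\<not> (AE x in M. 1 \<le> green x)"
proof
  assume *: "AE x in M. 1 \<le> green x"
  have "ennreal (measure M (space M)) = (\<integral>\<^sup>+x. 1 \<partial>M)"
    by (simp add: emeasure_eq_measure)
  also have "\<dots> \<le> (\<integral>\<^sup>+x. (\<Sum>j. ennreal ((T ^^ Suc j) (\<lambda>y. 1 / S y) x)) \<partial>M)"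
  proof (rule nn_integral_mono_AE)
    show "AE x in M. 1 \<le> (\<Sum>j. ennreal ((T ^^ Suc j) (\<lambda>y. 1 / S y) x))"
      using * AE_summable_green Tn_inv_S_nonneg
    proof eventually_elim
      case (elim x)
      then have "(\<Sum>j. ennreal ((T ^^ Suc j) (\<lambda>y. 1 / S y) x)) = ennreal (green x)"
        unfolding green_def by (intro suminf_ennreal2) (auto simp del: funpow.simps)
      with elim(1) show ?case by (simp add: ennreal_leI del: funpow.simps flip: ennreal_1)
    qed
  qed
  also have "\<dots> \<le> ennreal (\<integral>x. 1 - 1 / S x \<partial>M)" by (rule nn_integral_green)
  also have "(\<integral>x. 1 - 1 / S x \<partial>M) = measure M (space M) - (\<integral>x. 1 / S x \<partial>M)"
    using ess_bounded_integrable[OF inv_S_bounded] by simp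
  finally have "(\<integral>x. 1 / S x \<partial>M) \<le> 0"
    using assms by (simp add: ennreal_le_iff2)
  moreover have nn: "AE x in M. 0 \<le> 1 / S x" using AE_S by eventually_elim auto
  then have "(\<integral>x. 1 / S x \<partial>M) \<ge> 0" by (rule Bochner_Integration.integral_nonneg_AE)
  ultimately have "(\<integral>x. 1 / S x \<partial>M) = 0" by simp
  then have "AE x in M. 1 / S x = 0"
    using integral_nonneg_eq_0_iff_AE[OF ess_bounded_integrable[OF inv_S_bounded] nn] by simp
  with AE_S have "AE x in M. False" by eventually_elim auto
  then have "emeasure M (space M) = 0"
    using AE_iff_measurable[of "space M" M "\<lambda>_. False"] by auto
  with assms show False by (simp add: emeasure_eq_measure)
qed

text \<open>The weight \<open>wt n / S\<close> that the average at \<open>y\<close> gives to the point \<open>(r ^^ n) y\<close> is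
  the product of \<open>1 - 1 / S\<close> along the orbit up to that point, divided by \<open>S ((r ^^ n) y)\<close>.
  Hence \<open>T ^^ n\<close> of this weight stays above \<open>(1 - green) / S\<close>.\<close>

lemma wt_div_S_le: "AE x in M. wt n x / S x \<le> 1 / S ((r ^^ n) x)"
proof (induction n)
  case (Suc n)
  show ?case using AE_S AE_r[OF Suc]
  proof eventually_elim
    case (elim x)
    have "wt (Suc n) x / S x = (wt n (r x) / S (r x)) * (D x * S (r x) / S x)"
      using elim(1) by simp
    also have "\<dots> \<le> (wt n (r x) / S (r x)) * 1"
      using elim(1) by (intro mult_left_mono) (auto simp: wt_nonneg)
    also have "\<dots> \<le> 1 / S ((r ^^ Suc n) x)" using elim(2) by (simp add: funpow_swap1)
    finally show ?case .
  qed
qed simp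

lemma Tn_wt_div_S_ge:
  "AE x in M. 1 / S x * (1 - (\<Sum>j<n. (T ^^ Suc j) (\<lambda>y. 1 / S y) x)) \<le> (T ^^ n) (\<lambda>y. wt n y / S y) x"
proof (induction n)
  case (Suc n)
  let ?i = "\<lambda>y. 1 / S y"
  let ?a = "\<lambda>n y. wt n y / S y"
  \<comment> \<open>From \<open>D x * S (r x) = S x - 1\<close>: the share of weight passed on from
    \<open>x\<close> to \<open>r x\<close> is \<open>1 - 1 / S x\<close>.\<close>
  have "AE x in M. ?a (Suc n) x = (1 - ?i x) * ?a n (r x)"
    using AE_S
  proof eventually_elim
    case (elim x)
    then show ?case by (simp add: field_simps)
  qed
  from Tn_AE_cong[OF this, of "Suc n"]
  have 1: "AE x in M. (T ^^ Suc n) (?a (Suc n)) x = (T ^^ n) (T (\<lambda>x. (1 - ?i x) * ?a n (r x))) x"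
    by (simp add: funpow_Suc_right del: funpow.simps wt.simps)
  have "AE x in M. 0 \<le> T ?i x"
    using Tn_inv_S_nonneg by eventually_elim (metis funpow_simps_right(1) funpow.simps(2) o_apply id_apply)
  with T_one[of 1] wt_div_S_le[of n]
  \<comment> \<open>Pulling \<open>?a n\<close> out of \<open>T\<close> costs the term
    \<open>?a n x * T ?i x\<close>; \<open>wt_div_S_le\<close> replaces its first factor by a
    function of \<open>(r ^^ n) x\<close>, which \<open>T ^^ n\<close> can release in turn.\<close>
  have "AE x in M. ?a n x - T ?i x * ?i ((r ^^ n) x) \<le> T (\<lambda>x. (1 - ?i x) * ?a n (r x)) x"
  proof (rule AE_mp[OF AE_conjI[OF _ AE_conjI]], intro AE_I2 impI)
    fix x assume x: "x \<in> space M"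
      and *: "T (\<lambda>y. 1) x = 1 \<and> ?a n x \<le> ?i ((r ^^ n) x) \<and> 0 \<le> T ?i x"
    have "T (\<lambda>x. (1 - ?i x) * ?a n (r x)) x = ?a n x * (1 - T ?i x)"
      using T_comp[OF x, of "\<lambda>x. 1 - ?i x" "?a n"] * by (simp add: T_diff)
    moreover have "?a n x * T ?i x \<le> ?i ((r ^^ n) x) * T ?i x"
      using * by (intro mult_right_mono) auto
    ultimately show "?a n x - T ?i x * ?i ((r ^^ n) x) \<le> T (\<lambda>x. (1 - ?i x) * ?a n (r x)) x"
      by (simp add: algebra_simps)
  qed
  from Tn_mono[OF this, of n]
  have 2: "AE x in M. (T ^^ n) (?a n) x - (T ^^ n) (\<lambda>x. T ?i x * ?i ((r ^^ n) x)) x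
      \<le> (T ^^ n) (T (\<lambda>x. (1 - ?i x) * ?a n (r x))) x"
    by (simp only: Tn_diff)
  have 3: "AE x in M. (T ^^ n) (\<lambda>x. T ?i x * ?i ((r ^^ n) x)) x = ?i x * (T ^^ Suc n) ?i x"
    using Tn_comp[of _ n "T ?i" ?i] by (auto simp: funpow_swap1)
  show ?case using 1 2 3 Suc
  proof eventually_elim
    case (elim x)
    have "?i x * (1 - (\<Sum>j<Suc n. (T ^^ Suc j) ?i x))
      = ?i x * (1 - (\<Sum>j<n. (T ^^ Suc j) ?i x)) - ?i x * (T ^^ Suc n) ?i x"
      by (simp add: algebra_simps del: funpow.simps)
    with elim show ?case by linarith
  qed
qed simp

text \<open>The fixed point built from \<open>f\<close>. Where the sequence diverges,
  \<open>lim\<close> is an unspecified value; \<open>harm_tendsto\<close> confines this to a null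
  set.\<close>

definition harm :: "('a \<Rightarrow> real) \<Rightarrow> 'a \<Rightarrow> real" where
  "harm f x = lim (\<lambda>n. (T ^^ n) (avg f) x)"

section \<open>Convergence of the iterated averages to a fixed point\<close>

context
  fixes f :: "'a \<Rightarrow> real"
  assumes f [measurable]: "f \<in> borel_measurable M"
    and f01: "range f \<subseteq> {0..1}"
begin

lemmas f0 = unit_rangeD(1)[OF f01] and f1 = unit_rangeD(2)[OF f01]

lemma avg_r_bounded: "ess_bounded M (\<lambda>y. avg f y - avg f (r y))"
  by (intro ess_bounded_diff ess_bounded_r avg_bounded f f01)

lemma Tn_avg_measurable [measurable]: "(T ^^ n) (avg f) \<in> borel_measurable M"
  by (intro ess_bounded_measurable Tn_bounded avg_bounded f f01)

text \<open>\<open>T\<close> fixes constants and therefore undoes composition with \<open>r\<close>.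
  So \<open>T ^^ n\<close> of \<open>avg f\<close> is \<open>T ^^ Suc n\<close> of
  \<open>avg f\<close> composed with \<open>r\<close>.\<close>

lemma Tn_avg_Suc:
  "AE x in M. (T ^^ Suc n) (avg f) x
     = (T ^^ n) (avg f) x + (T ^^ Suc n) (\<lambda>y. avg f y - avg f (r y)) x"
proof -
  have "AE x in M. T (\<lambda>y. 1 * avg f (r y)) x = avg f x"
    using T_one[of 1]
  proof (rule AE_mp, intro AE_I2 impI)
    fix x assume "x \<in> space M" "T (\<lambda>y. 1) x = 1"
    then show "T (\<lambda>y. 1 * avg f (r y)) x = avg f x" by (subst T_comp) auto
  qed
  from Tn_AE_cong[OF this, of n]
  have "AE x in M. (T ^^ Suc n) (\<lambda>y. avg f (r y)) x = (T ^^ n) (avg f) x"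
    by (simp add: funpow_Suc_right del: funpow.simps)
  then show ?thesis unfolding Tn_diff by eventually_elim simp
qed

lemma Tn_avg_bounds: "AE x in M. \<forall>n. 0 \<le> (T ^^ n) (avg f) x \<and> (T ^^ n) (avg f) x \<le> 1"
  unfolding AE_all_countable
proof
  fix n
  have "AE x in M. 0 \<le> avg f x" "AE x in M. avg f x \<le> 1"
    using avg_bounds[OF f01] by auto
  from Tn_nonneg[OF this(1), of n] Tn_mono[OF this(2), of n] Tn_const[of n 1]
  show "AE x in M. 0 \<le> (T ^^ n) (avg f) x \<and> (T ^^ n) (avg f) x \<le> 1"
    by eventually_elim auto
qed

text \<open>By \<open>Tn_avg_Suc\<close> and \<open>avg_diff_le\<close> the increments are dominated
  by the terms of the Green series, which converges almost everywhere.\<close>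

lemma harm_tendsto: "AE x in M. (\<lambda>n. (T ^^ n) (avg f) x) \<longlonglongrightarrow> harm f x"
proof -
  have "AE x in M. \<forall>n. \<bar>(T ^^ Suc n) (avg f) x - (T ^^ n) (avg f) x\<bar> \<le> (T ^^ Suc n) (\<lambda>y. 1 / S y) x"
    unfolding AE_all_countable
  proof
    fix n
    show "AE x in M. \<bar>(T ^^ Suc n) (avg f) x - (T ^^ n) (avg f) x\<bar> \<le> (T ^^ Suc n) (\<lambda>y. 1 / S y) x"
      using Tn_avg_Suc[of n] Tn_abs_le[OF avg_diff_le[OF f01], of "Suc n"]
      by eventually_elim linarith
  qed
  with AE_summable_green show ?thesis
  proof eventually_elim
    case (elim x)
    let ?a = "\<lambda>n. (T ^^ n) (avg f) x"
    have "summable (\<lambda>n. ?a (Suc n) - ?a n)"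
      by (rule summable_comparison_test'[OF elim(1)]) (use elim(2) in \<open>simp only: real_norm_def\<close>)
    then have "(\<lambda>n. ?a n - ?a 0) \<longlonglongrightarrow> (\<Sum>n. ?a (Suc n) - ?a n)"
      using summable_LIMSEQ[of "\<lambda>n. ?a (Suc n) - ?a n"]
      unfolding sum_lessThan_telescope[of ?a] by blast
    then have "(\<lambda>n. ?a n - ?a 0 + ?a 0) \<longlonglongrightarrow> (\<Sum>n. ?a (Suc n) - ?a n) + ?a 0"
      by (intro tendsto_add tendsto_const)
    then have "convergent ?a" unfolding convergent_def by auto
    then show ?case unfolding harm_def by (simp add: convergent_LIMSEQ_iff)
  qed
qed

lemma harm_measurable [measurable]: "harm f \<in> borel_measurable M"
  unfolding harm_def by (rule borel_measurable_lim_metric) (rule Tn_avg_measurable)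

lemma harm_bounded: "ess_bounded M (harm f)"
proof (rule ess_boundedI[where C=1])
  show "AE x in M. \<bar>harm f x\<bar> \<le> 1"
    using harm_tendsto Tn_avg_bounds
  proof eventually_elim
    case (elim x)
    have "(\<lambda>n. \<bar>(T ^^ n) (avg f) x\<bar>) \<longlonglongrightarrow> \<bar>harm f x\<bar>" by (rule tendsto_rabs[OF elim(1)])
    then show ?case using elim(2) by (intro LIMSEQ_le_const2) (auto simp: abs_le_iff intro: order_trans[of _ 0])
  qed
qed (rule harm_measurable)

text \<open>Almost every fibre lies wholly in the set of convergence, so the limit passes through
  the fibre sum.\<close>

lemma T_harm: "AE x in M. T (harm f) x = harm f x"
  using AE_fibre[OF harm_tendsto] harm_tendsto
proof eventually_elim
  case (elim x)
  have "(\<lambda>n. T ((T ^^ n) (avg f)) x) \<longlonglongrightarrow> T (harm f) x"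
    using elim(1) by (intro T_tendsto) blast
  then have "(\<lambda>n. (T ^^ Suc n) (avg f) x) \<longlonglongrightarrow> T (harm f) x" by simp
  moreover have "(\<lambda>n. (T ^^ Suc n) (avg f) x) \<longlonglongrightarrow> harm f x"
    using elim(2) by (rule LIMSEQ_Suc)
  ultimately show ?case by (rule LIMSEQ_unique)
qed

text \<open>Summing the increments and moving the powers of \<open>T\<close> onto weights turns the
  integral of \<open>(T ^^ n) (avg f)\<close> into that of \<open>?F n\<close>. Pointwise,
  \<open>?F n\<close> tends to \<open>avg f + (S - 1) * ?d\<close>, which is \<open>f\<close>
  because \<open>S * ?d\<close> is \<open>f\<close> minus \<open>avg f\<close> composed with
  \<open>r\<close>.\<close>

lemma integral_harm: "(\<integral>x. harm f x \<partial>M) = (\<integral>x. f x \<partial>M)"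
proof -
  let ?d = "\<lambda>y. avg f y - avg f (r y)"
  let ?F = "\<lambda>n x. avg f x + (\<Sum>j<n. wt (Suc j) x * ?d x)"
  have bd: "ess_bounded M (\<lambda>x. wt j x * ?d x)" for j
    by (intro ess_bounded_mult wt_bounded avg_r_bounded)
  have ba: "ess_bounded M (avg f)" by (rule avg_bounded[OF f f01])
  have bF: "ess_bounded M (?F n)" for n
    by (intro ess_bounded_add ess_bounded_sum bd ba)
  have F: "(\<integral>x. (T ^^ n) (avg f) x \<partial>M) = (\<integral>x. ?F n x \<partial>M)" for n
  proof (induction n)
    case (Suc n)
    have "(\<integral>x. (T ^^ Suc n) (avg f) x \<partial>M)
        = (\<integral>x. (T ^^ n) (avg f) x + (T ^^ Suc n) ?d x \<partial>M)"
      using Tn_avg_Suc[of n]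
      by (intro integral_cong_AE ess_bounded_measurable ess_bounded_add Tn_bounded ba avg_r_bounded)
    also have "\<dots> = (\<integral>x. (T ^^ n) (avg f) x \<partial>M) + (\<integral>x. (T ^^ Suc n) ?d x \<partial>M)"
      by (intro Bochner_Integration.integral_add ess_bounded_integrable Tn_bounded ba avg_r_bounded)
    also have "\<dots> = (\<integral>x. ?F n x \<partial>M) + (\<integral>x. wt (Suc n) x * ?d x \<partial>M)"
      unfolding Suc integral_Tn[OF avg_r_bounded] ..
    also have "\<dots> = (\<integral>x. ?F n x + wt (Suc n) x * ?d x \<partial>M)"
      by (intro Bochner_Integration.integral_add[symmetric] ess_bounded_integrable bd bF)
    finally show ?case by (simp add: add.assoc del: wt.simps funpow.simps)
  qed simp
  have "(\<lambda>n. \<integral>x. ?F n x \<partial>M) \<longlonglongrightarrow> (\<integral>x. f x \<partial>M)"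
  \<comment> \<open>One unit bounds \<open>avg f\<close>; the other bounds weights of total at most
    \<open>S\<close> times a difference of size at most \<open>1 / S\<close>.\<close>
  proof (rule integral_dominated_convergence[where w="\<lambda>_. 2"])
    show "AE x in M. (\<lambda>n. ?F n x) \<longlonglongrightarrow> f x"
      using AE_summable AE_S avg_diff[OF f01]
    proof eventually_elim
      case (elim x)
      have "summable (\<lambda>j. wt (Suc j) x)" using elim(1) by (subst summable_Suc_iff)
      then have "(\<lambda>n. \<Sum>j<n. wt (Suc j) x) \<longlonglongrightarrow> (\<Sum>j. wt (Suc j) x)"
        by (rule summable_LIMSEQ)
      moreover have "(\<Sum>j. wt (Suc j) x) = S x - 1"
        unfolding S_def using suminf_split_head[OF elim(1)] by simp
      ultimately have "(\<lambda>n. avg f x + (\<Sum>j<n. wt (Suc j) x) * ?d x) \<longlonglongrightarrow> avg f x + (S x - 1) * ?d x"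
        by (intro tendsto_intros) auto
      moreover have "avg f x + (S x - 1) * ?d x = f x"
      proof -
        have "S x * ?d x = f x - avg f (r x)" using elim(2,3) by auto
        then show ?thesis by (simp add: algebra_simps)
      qed
      ultimately show ?case by (simp only: sum_distrib_right)
    qed
    show "AE x in M. norm (?F n x) \<le> 2" for n
      using AE_summable AE_S avg_bounds[OF f01] avg_diff_le[OF f01]
    proof eventually_elim
      case (elim x)
      have "(\<Sum>j<n. wt (Suc j) x) \<le> S x"
        using S_ge_sum[OF elim(1), of "Suc n"] by (subst (asm) sum.lessThan_Suc_shift) simp
      then have "(\<Sum>j<n. wt (Suc j) x) * \<bar>?d x\<bar> \<le> S x * (1 / S x)"
        using elim(2,4) by (intro mult_mono) auto
      moreover have "\<bar>(\<Sum>j<n. wt (Suc j) x * ?d x)\<bar> = (\<Sum>j<n. wt (Suc j) x) * \<bar>?d x\<bar>"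
        unfolding sum_distrib_right[symmetric] abs_mult
        by (simp add: sum_nonneg wt_nonneg del: wt.simps)
      ultimately show ?case using elim(2,3) by (auto simp del: wt.simps)
    qed
  qed (auto simp del: wt.simps intro: ess_bounded_measurable[OF bF])
  moreover have "(\<lambda>n. \<integral>x. (T ^^ n) (avg f) x \<partial>M) \<longlonglongrightarrow> (\<integral>x. harm f x \<partial>M)"
  proof (rule integral_dominated_convergence[where w="\<lambda>_. 1"])
    show "AE x in M. (\<lambda>n. (T ^^ n) (avg f) x) \<longlonglongrightarrow> harm f x" by (rule harm_tendsto)
    show "AE x in M. norm ((T ^^ n) (avg f) x) \<le> 1" for n
      using Tn_avg_bounds by eventually_elim (auto simp: abs_le_iff intro: order_trans[of _ 0])
  qed auto
  ultimately show ?thesis unfolding F by (rule LIMSEQ_unique[rotated])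
qed

text \<open>Of the average only the term of index \<open>n\<close> is kept. Then
  \<open>T ^^ n\<close> releases the factor \<open>f\<close> and leaves \<open>T ^^ n\<close> of
  \<open>wt n / S\<close>, bounded below by \<open>Tn_wt_div_S_ge\<close> for every
  \<open>n\<close>.\<close>

lemma harm_ge: "AE x in M. f x * (1 / S x * (1 - green x)) \<le> harm f x"
proof -
  have step: "AE x in M. f x * (1 / S x * (1 - (\<Sum>j<n. (T ^^ Suc j) (\<lambda>y. 1 / S y) x))) \<le> (T ^^ n) (avg f) x"
    for n
  proof -
    have "AE x in M. wt n x / S x * f ((r ^^ n) x) \<le> avg f x"
      using AE_summable
    proof eventually_elim
      case (elim x)
      have "(\<Sum>j\<in>{n}. wt j x * f ((r ^^ j) x)) \<le> (\<Sum>j. wt j x * f ((r ^^ j) x))"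
        by (intro sum_le_suminf summable_wt_mult elim f01) (auto simp: wt_nonneg f0)
      then show ?case using S_ge_1[OF elim] by (simp add: avg_def divide_right_mono)
    qed
    from Tn_mono[OF this, of n]
    have "AE x in M. f x * (T ^^ n) (\<lambda>x. wt n x / S x) x \<le> (T ^^ n) (avg f) x"
      using Tn_comp[of _ n "\<lambda>x. wt n x / S x" f] by auto
    with Tn_wt_div_S_ge[of n] show ?thesis
      by eventually_elim (meson f0 mult_left_mono order_trans)
  qed
  have "AE x in M. \<forall>n. f x * (1 / S x * (1 - (\<Sum>j<n. (T ^^ Suc j) (\<lambda>y. 1 / S y) x))) \<le> (T ^^ n) (avg f) x"
    unfolding AE_all_countable using step by blast
  with harm_tendsto AE_summable_green show ?thesis
  proof eventually_elim
    case (elim x)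
    have "(\<lambda>n. f x * (1 / S x * (1 - (\<Sum>j<n. (T ^^ Suc j) (\<lambda>y. 1 / S y) x))))
      \<longlonglongrightarrow> f x * (1 / S x * (1 - green x))"
      unfolding green_def by (intro tendsto_intros summable_LIMSEQ elim(2))
    then show ?case using elim(1,3) by (intro LIMSEQ_le) (auto simp del: funpow.simps)
  qed
qed

end

text \<open>If every fixed point were constant, \<open>integral_harm\<close> would give
  \<open>harm (indicator B)\<close> the value \<open>measure M B / measure M (space M)\<close>. By
  \<open>harm_ge\<close> this bounds \<open>(1 - green) / S\<close> on \<open>B\<close>, and
  \<open>cover\<close>, which expresses the absence of point masses, makes the bound arbitrarily
  small everywhere.\<close>

lemma nonconstant_fixed_point:
  assumes pos: "measure M (space M) > 0"
    and cover: "\<And>\<epsilon>. \<epsilon> > 0 \<Longrightarrow> \<exists>F. finite F \<and> F \<subseteq> sets M \<and> space M \<subseteq> \<Union>F \<and> (\<forall>B\<in>F. measure M B < \<epsilon>)"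
  shows "\<exists>u. ess_bounded M u \<and> (AE x in M. T u x = u x) \<and> \<not> (\<exists>c. AE x in M. u x = c)"
proof (rule ccontr)
  assume neg: "\<not> ?thesis"
  have ineq: "AE x in M. x \<in> B \<longrightarrow> 1 / S x * (1 - green x) \<le> measure M B / measure M (space M)"
    if B [measurable]: "B \<in> sets M" for B
  proof -
    have fB: "(indicator B :: 'a \<Rightarrow> real) \<in> borel_measurable M"
      "range (indicator B :: 'a \<Rightarrow> real) \<subseteq> {0..1}"
      by (auto simp: indicator_def)
    obtain c where c: "AE x in M. harm (indicator B) x = c"
      using neg harm_bounded[OF fB] T_harm[OF fB] by blast
    have "c * measure M (space M) = (\<integral>x. c \<partial>M)" by simp
    also have "\<dots> = (\<integral>x. harm (indicator B) x \<partial>M)"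
      using c harm_measurable[OF fB] by (intro integral_cong_AE) auto
    also have "\<dots> = measure M B" using integral_harm[OF fB] by simp
    finally have "c = measure M B / measure M (space M)" using pos by (simp add: field_simps)
    with c harm_ge[OF fB] show ?thesis
      by (auto elim!: AE_mp simp: indicator_def)
  qed
  have "AE x in M. 1 / S x * (1 - green x) \<le> 1 / real (Suc n)" for n
  proof -
    obtain F where F: "finite F" "F \<subseteq> sets M" "space M \<subseteq> \<Union>F"
      "\<And>B. B \<in> F \<Longrightarrow> measure M B < measure M (space M) / real (Suc n)"
      using cover[of "measure M (space M) / real (Suc n)"] pos by auto
    have "AE x in M. \<forall>B\<in>F. x \<in> B \<longrightarrow> 1 / S x * (1 - green x) \<le> measure M B / measure M (space M)"
      using F(1,2) ineq by (auto simp: AE_ball_countable[OF countable_finite])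
    then show ?thesis
    proof (rule AE_mp, intro AE_I2 impI)
      fix x assume x: "x \<in> space M"
        and *: "\<forall>B\<in>F. x \<in> B \<longrightarrow> 1 / S x * (1 - green x) \<le> measure M B / measure M (space M)"
      obtain B where "B \<in> F" "x \<in> B" using x F(3) by auto
      moreover have "measure M B / measure M (space M) \<le> 1 / real (Suc n)"
        using F(4)[OF \<open>B \<in> F\<close>] pos by (simp add: field_simps)
      ultimately show "1 / S x * (1 - green x) \<le> 1 / real (Suc n)" using * by fastforce
    qed
  qed
  then have "AE x in M. \<forall>n. 1 / S x * (1 - green x) \<le> 1 / real (Suc n)"
    unfolding AE_all_countable by blast
  with AE_S have "AE x in M. 1 \<le> green x"
  proof eventually_elim
    case (elim x)
    have "1 / S x * (1 - green x) \<le> 0"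
      using elim(2) LIMSEQ_inverse_real_of_nat
      by (intro LIMSEQ_le_const[OF LIMSEQ_inverse_real_of_nat]) (auto simp: inverse_eq_divide)
    with elim(1) show ?case by (simp add: zero_le_mult_iff mult_le_0_iff divide_le_0_iff)
  qed
  with not_AE_green_ge_1[OF pos] show False by simp
qed

text \<open>Along the orbit of a point mass at least half as large as any other, the masses
  cannot double, so all fibres are singletons and \<open>D = 1\<close>: then \<open>S\<close> diverges there.\<close>

lemma no_point_mass:
  assumes single: "\<And>x. x \<in> space M \<Longrightarrow> {x} \<in> sets M" and a: "a \<in> space M"
  shows "measure M {a} = 0"
proof (rule ccontr)
  assume ne: "measure M {a} \<noteq> 0"
  \<comment> \<open>The fibre mean of the indicator of \<open>{y}\<close> lives on the single point
    \<open>r y\<close>, with value \<open>1 / ?N (r y)\<close>; integrating it compares the two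
    masses.\<close>
  let ?N = "\<lambda>x. card (fibre x)"
  have mass: "measure M {r y} = ?N (r y) * measure M {y}" if y: "y \<in> space M" for y
  proof -
    have ry: "r y \<in> space M" by (rule r_space[OF y])
    have "measure M {y} = (\<integral>x. fibre_mean (space M) r (indicator {y}) x \<partial>M)"
      using mean[OF ess_bounded_indicator[OF single[OF y]]] y
      by (simp add: has_bochner_integral_iff single)
    also have "\<dots> = (\<integral>x. (1 / ?N (r y)) * indicator {r y} x \<partial>M)"
    proof (rule Bochner_Integration.integral_cong[OF refl])
      fix x assume x: "x \<in> space M"
      show "fibre_mean (space M) r (indicator {y}) x = (1 / ?N (r y)) * (indicator {r y} x :: real)"
        using finite_fibre[OF x] y
        by (auto simp: fibre_mean_def indicator_def sum.delta)
    qed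
    also have "\<dots> = measure M {r y} / ?N (r y)" using ry single[OF ry] by simp
    finally show ?thesis using card_fibre_pos[OF ry] by (simp add: field_simps)
  qed
  have mono: "measure M {y} \<le> measure M {r y}" if "y \<in> space M" for y
    using mass[OF that] card_fibre_pos[OF r_space[OF that]]
    by (simp add: mult_le_cancel_right1 Suc_le_eq)
  define s where "s = (SUP y\<in>space M. measure M {y})"
  have bdd: "bdd_above ((\<lambda>y. measure M {y}) ` space M)"
    by (auto simp: bdd_above_def intro!: bounded_measure)
  have le_s: "measure M {y} \<le> s" if "y \<in> space M" for y
    unfolding s_def by (rule cSUP_upper[OF that bdd])
  have "s > 0" using le_s[OF a] ne measure_nonneg[of M "{a}"] by linarith
  then obtain b where b: "b \<in> space M" "s / 2 < measure M {b}"
    using less_cSUP_iff[OF _ bdd, of "s / 2"] a unfolding s_def by auto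
  have big: "s / 2 < measure M {(r ^^ n) b}" for n
    by (induction n) (use b mono rn_space[OF b(1)] in \<open>auto intro: less_le_trans\<close>)
  have one: "?N ((r ^^ Suc n) b) = 1" for n
  proof (rule ccontr)
    let ?y = "(r ^^ n) b"
    assume "?N ((r ^^ Suc n) b) \<noteq> 1"
    then have "2 \<le> ?N (r ?y)" using card_fibre_pos[OF rn_space[OF b(1), of "Suc n"]] by simp
    then have "2 * measure M {?y} \<le> measure M {r ?y}"
      unfolding mass[OF rn_space[OF b(1)]] by (intro mult_right_mono) auto
    then show False using le_s[OF rn_space[OF b(1), of "Suc n"]] big[of n] by simp
  qed
  \<comment> \<open>Points of positive mass escape every null set, so \<open>D_mean\<close> can be
    evaluated along the orbit of \<open>b\<close> and \<open>AE_summable\<close> at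
    \<open>b\<close>.\<close>
  have AE_at: "P x" if P: "AE x in M. P x" and x: "x \<in> space M" "measure M {x} > 0" for P x
  proof (rule ccontr)
    assume "\<not> P x"
    obtain N where N: "N \<in> null_sets M" "{x\<in>space M. \<not> P x} \<subseteq> N"
      using P unfolding eventually_ae_filter by auto
    have "measure M {x} \<le> measure M N"
      using N x(1) \<open>\<not> P x\<close> by (intro finite_measure_mono) auto
    with N x(2) show False by (simp add: null_setsD1 measure_def)
  qed
  have D1: "D ((r ^^ n) b) = 1" for n
  proof -
    let ?y = "(r ^^ n) b"
    have y: "?y \<in> space M" by (rule rn_space[OF b(1)])
    obtain z where z: "fibre (r ?y) = {z}" using one[of n] by (auto simp: card_1_singleton_iff)
    moreover have "?y \<in> fibre (r ?y)" using y by (simp only: Int_iff vimage_eq) simp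
    ultimately have z': "fibre (r ?y) = {?y}" by (metis singletonD)
    have "fibre_mean (space M) r D (r ?y) = 1"
      using AE_at[OF D_mean r_space[OF y]] big[of "Suc n"] \<open>s > 0\<close> by simp
    then show ?thesis by (simp add: fibre_mean_def z')
  qed
  have "wt n ((r ^^ k) b) = 1" for n k
  proof (induction n arbitrary: k)
    case (Suc n)
    show ?case using Suc[of "Suc k"] D1[of k] by simp
  qed simp
  from this[of _ 0] have "\<not> summable (\<lambda>n. wt n b)" by (simp add: summable_const_iff)
  moreover have "summable (\<lambda>n. wt n b)"
    using AE_at[OF AE_summable b(1)] b(2) \<open>s > 0\<close> by simp
  ultimately show False by simp
qed

end

section \<open>Solutions of the scaling equation\<close>

lemma Linfty_ess_bounded: "F \<in> Linfty M \<Longrightarrow> ess_bounded M (\<lambda>x. cmod (F x))"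
  by (auto simp: Linfty_def intro!: ess_boundedI)

lemma Linfty_mult:
  assumes "f \<in> Linfty M" "g \<in> Linfty M"
  shows "(\<lambda>x. f x * g x) \<in> Linfty M"
  using ess_bounded_mult[OF assms[THEN Linfty_ess_bounded]] assms
  by (auto simp: Linfty_def ess_bounded_def norm_mult)

lemma Linfty_of_real: "ess_bounded M u \<Longrightarrow> (\<lambda>x. complex_of_real (u x)) \<in> Linfty M"
  by (auto simp: Linfty_def ess_bounded_def)

lemma Linfty_const: "(\<lambda>x. c) \<in> Linfty M"
  by (auto simp: Linfty_def)

lemma Linfty_diff:
  assumes "f \<in> Linfty M" "g \<in> Linfty M"
  shows "(\<lambda>x. f x - g x) \<in> Linfty M"
proof -
  obtain A B where "AE x in M. cmod (f x) \<le> A" "AE x in M. cmod (g x) \<le> B"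
    using assms by (auto simp: Linfty_def)
  then have "AE x in M. cmod (f x - g x) \<le> A + B"
    by eventually_elim (meson add_mono norm_triangle_ineq4 order_trans)
  with assms show ?thesis by (auto simp: Linfty_def)
qed

lemma Linfty_cnj: "f \<in> Linfty M \<Longrightarrow> (\<lambda>x. cnj (f x)) \<in> Linfty M"
  using borel_measurable_continuous_onI[of cnj] measurable_compose[of f M borel cnj borel]
  by (auto simp: Linfty_def continuous_intros)

lemma (in fibred) Linfty_rn: "f \<in> Linfty M \<Longrightarrow> (\<lambda>x. f ((r ^^ n) x)) \<in> Linfty M"
  unfolding Linfty_def
  using measurable_compose[OF rn_measurable[of n], of f borel] AE_rn[of "\<lambda>x. cmod (f x) \<le> _" n]
  by fastforce

section \<open>Computations in a wavelet representation\<close>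

locale wavelet = transfer M r D for M :: "'a measure" and r D +
  fixes m0 :: "'a \<Rightarrow> complex" and U :: "'h::complex_hilbert_space \<Rightarrow> 'h" and \<pi> \<phi>
  assumes m0: "m0 \<in> Linfty M" and D_eq: "D x = (cmod (m0 x))\<^sup>2"
    and rep: "wavelet_representation r M m0 U \<pi> \<phi>"
begin

abbreviation "V \<equiv> inv U"

lemma unitary: "unitary_operator U" and star: "star_representation M \<pi>"
  and cov: "f \<in> Linfty M \<Longrightarrow> U \<circ> \<pi> f \<circ> V = \<pi> (f \<circ> r)"
  and scaling: "U \<phi> = \<pi> m0 \<phi>"
  and orth: "f \<in> Linfty M \<Longrightarrow> cinner (\<pi> f \<phi>) \<phi> = (\<integral>x. f x \<partial>M)"
  using rep unfolding wavelet_representation_def by blast+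

lemma U_linear: "bounded_linear U" and U_scaleC: "U (c *\<^sub>C v) = c *\<^sub>C U v"
  using unitary unfolding unitary_operator_def bounded_clinear_def by blast+

lemma norm_U: "norm (U v) = norm v"
proof -
  have "complex_of_real ((norm (U v))\<^sup>2) = complex_of_real ((norm v)\<^sup>2)"
    using unitary unfolding cinner_self[symmetric] unitary_operator_def by blast
  then have "(norm (U v))\<^sup>2 = (norm v)\<^sup>2" unfolding of_real_eq_iff .
  then show ?thesis by (simp add: power2_eq_iff_nonneg)
qed

lemma U_V: "U (V x) = x"
  using unitary by (simp add: unitary_operator_def surj_f_inv_f)

lemma V_U: "V (U x) = x"
proof -
  have "inj U"
  proof (rule injI)
    fix x y assume "U x = U y"
    then have "norm (U (x - y)) = 0" using U_linear by (simp add: linear_simps)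
    then show "x = y" by (simp add: norm_U)
  qed
  then show ?thesis by (rule inv_f_f)
qed

lemma Un_Vn: "(U ^^ n) ((V ^^ n) x) = x"
  by (induction n arbitrary: x) (auto simp: U_V funpow_swap1[of U])

lemma Vn_Un: "(V ^^ n) ((U ^^ n) x) = x"
  by (induction n arbitrary: x) (auto simp: V_U funpow_swap1[of V])

lemma norm_Un: "norm ((U ^^ n) x) = norm x"
  by (induction n) (auto simp: norm_U)

lemma Un_diff: "(U ^^ n) (x - y) = (U ^^ n) x - (U ^^ n) y"
  using U_linear by (induction n) (auto simp: linear_simps)

lemma Un_scaleC: "(U ^^ n) (c *\<^sub>C x) = c *\<^sub>C (U ^^ n) x"
  by (induction n) (auto simp: U_scaleC)

lemma pi_add: "f \<in> Linfty M \<Longrightarrow> g \<in> Linfty M \<Longrightarrow> \<pi> (\<lambda>x. f x + g x) v = \<pi> f v + \<pi> g v"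
  and pi_scaleC: "f \<in> Linfty M \<Longrightarrow> \<pi> (\<lambda>x. c * f x) v = c *\<^sub>C \<pi> f v"
  and pi_mult: "f \<in> Linfty M \<Longrightarrow> g \<in> Linfty M \<Longrightarrow> \<pi> (\<lambda>x. f x * g x) v = \<pi> f (\<pi> g v)"
  and pi_adj: "f \<in> Linfty M \<Longrightarrow> cinner (\<pi> (\<lambda>x. cnj (f x)) v) w = cinner v (\<pi> f w)"
  and pi_linear: "f \<in> Linfty M \<Longrightarrow> bounded_linear (\<pi> f)"
  using star unfolding star_representation_def bounded_clinear_def by blast+

lemma pi_diff:
  assumes f: "f \<in> Linfty M" and g: "g \<in> Linfty M"
  shows "\<pi> (\<lambda>x. f x - g x) v = \<pi> f v - \<pi> g v"
proof -
  have "\<pi> f v = \<pi> (\<lambda>x. (f x - g x) + g x) v" by simp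
  also have "\<dots> = \<pi> (\<lambda>x. f x - g x) v + \<pi> g v" by (rule pi_add[OF Linfty_diff[OF f g] g])
  finally show ?thesis by simp
qed

lemma U_pi:
  assumes "f \<in> Linfty M"
  shows "U (\<pi> f x) = \<pi> (\<lambda>x. f (r x)) (U x)"
  using fun_cong[OF cov[OF assms], of "U x"] by (simp add: V_U o_def)

lemma Un_pi:
  "f \<in> Linfty M \<Longrightarrow> (U ^^ n) (\<pi> f x) = \<pi> (\<lambda>x. f ((r ^^ n) x)) ((U ^^ n) x)"
proof (induction n)
  case (Suc n)
  then show ?case using U_pi[OF Linfty_rn[OF Suc.prems, of n]] by (simp add: funpow_swap1[of r])
qed simp

text \<open>The adjoint rule reduces the norm to \<open>\<pi>\<close> of \<open>cnj F * F\<close>,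
  to which \<open>orth\<close> applies. Norms in the Hilbert space thus become integrals.\<close>

lemma norm_pi:
  assumes F: "F \<in> Linfty M"
  shows "(norm (\<pi> F \<phi>))\<^sup>2 = (\<integral>x. (cmod (F x))\<^sup>2 \<partial>M)"
proof -
  have "complex_of_real ((norm (\<pi> F \<phi>))\<^sup>2) = cinner (\<pi> (\<lambda>x. cnj (F x)) (\<pi> F \<phi>)) \<phi>"
    unfolding cinner_self[symmetric] pi_adj[OF F] ..
  also have "\<dots> = (\<integral>x. cnj (F x) * F x \<partial>M)"
    using orth[OF Linfty_mult[OF Linfty_cnj[OF F] F]] by (simp add: pi_mult[OF Linfty_cnj[OF F] F])
  also have "(\<lambda>x. cnj (F x) * F x) = (\<lambda>x. complex_of_real ((cmod (F x))\<^sup>2))"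
    by (intro ext) (simp only: complex_norm_square mult.commute)
  also have "(\<integral>x. complex_of_real ((cmod (F x))\<^sup>2) \<partial>M) = complex_of_real (\<integral>x. (cmod (F x))\<^sup>2 \<partial>M)"
    by (rule integral_complex_of_real)
  finally show ?thesis unfolding of_real_eq_iff .
qed

primrec mn :: "nat \<Rightarrow> 'a \<Rightarrow> complex" where
  "mn 0 = (\<lambda>x. 1)"
| "mn (Suc n) = (\<lambda>x. m0 x * mn n (r x))"

lemma mn_Linfty: "mn n \<in> Linfty M"
proof (induction n)
  case (Suc n)
  show ?case using Linfty_mult[OF m0 Linfty_rn[OF Suc, of 1]] by simp
qed (simp add: Linfty_const)

lemma mn_add: "mn (m + k) x = mn k x * mn m ((r ^^ k) x)"
  by (induction k arbitrary: x) (simp_all add: funpow_swap1)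

lemma mn_norm: "(cmod (mn n x))\<^sup>2 = wt n x"
  by (induction n arbitrary: x) (simp_all add: norm_mult power_mult_distrib D_eq)

text \<open>Covariance composes \<open>mn n\<close> with \<open>r\<close>, and the scaling equation
  supplies the new factor \<open>m0\<close>. Exponent 0 is left out because it would assert that
  \<open>\<pi>\<close> of the constant 1 fixes \<open>\<phi>\<close>, and unitality is not among the
  axioms of \<open>star_representation\<close>.\<close>

lemma Un_phi:
  assumes "n > 0"
  shows "(U ^^ n) \<phi> = \<pi> (mn n) \<phi>"
  using assms
proof (induction n rule: nat_induct_non_zero)
  case 1
  show ?case by (simp add: scaling)
next
  case (Suc n)
  have r: "(\<lambda>x. mn n (r x)) \<in> Linfty M" using Linfty_rn[OF mn_Linfty, of n 1] by simp
  have "(U ^^ Suc n) \<phi> = \<pi> (\<lambda>x. mn n (r x)) (\<pi> m0 \<phi>)"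
    by (simp add: Suc.IH U_pi[OF mn_Linfty] scaling)
  also have "\<dots> = \<pi> (\<lambda>x. mn n (r x) * m0 x) \<phi>" using pi_mult[OF r m0] by simp
  finally show ?case by (simp add: mult.commute)
qed

text \<open>For positive \<open>n\<close>, \<open>v n\<close> is \<open>\<pi> u\<close> conjugated
  by \<open>U ^^ n\<close> and applied to \<open>\<phi>\<close>. Its squared distances are
  differences of the bounded increasing sequence \<open>I\<close>, so it converges.\<close>

lemma scaling_solution:
  assumes u: "ess_bounded M u" and fixed: "AE x in M. T u x = u x"
    and nc: "\<not> (\<exists>c. AE x in M. u x = c)"
  shows "\<exists>\<phi>'. U \<phi>' = \<pi> m0 \<phi>' \<and> (\<forall>c. \<phi>' \<noteq> c *\<^sub>C \<phi>)"
proof -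
  define F where "F n x = complex_of_real (u x) * mn n x" for n x
  define v where "v n = (V ^^ n) (\<pi> (F n) \<phi>)" for n
  define I where "I n = (\<integral>x. wt n x * (u x)\<^sup>2 \<partial>M)" for n
  have F: "F n \<in> Linfty M" for n
    unfolding F_def by (intro Linfty_mult mn_Linfty Linfty_of_real u)
  \<comment> \<open>The isometry \<open>U ^^ (m + k)\<close> makes both vectors images of
    \<open>\<phi>\<close> under \<open>\<pi>\<close>. The case \<open>k = 0\<close> is separate
    because \<open>Un_phi\<close> requires a positive exponent.\<close>
  have dist: "(norm (v (m + k) - v m))\<^sup>2 = I (m + k) - I m" for m k
  proof (cases "k = 0")
    case False
    let ?G = "\<lambda>x. F m ((r ^^ k) x) * mn k x"
    have "(U ^^ (m + k)) (v m) = (U ^^ k) (\<pi> (F m) \<phi>)"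
      by (subst add.commute) (simp only: v_def funpow_add o_apply Un_Vn)
    also have "\<dots> = \<pi> ?G \<phi>"
      using False by (simp add: Un_pi[OF F] Un_phi pi_mult[OF Linfty_rn[OF F] mn_Linfty])
    finally have "norm (v (m + k) - v m) = norm (\<pi> (F (m + k)) \<phi> - \<pi> ?G \<phi>)"
      using norm_Un[of "m + k" "v (m + k) - v m"] unfolding Un_diff
      by (simp only: v_def[of "m + k"] Un_Vn)
    also have "\<dots> = norm (\<pi> (\<lambda>x. F (m + k) x - ?G x) \<phi>)"
      by (subst pi_diff[OF F Linfty_mult[OF Linfty_rn[OF F] mn_Linfty]]) simp
    finally have "(norm (v (m + k) - v m))\<^sup>2 = (\<integral>x. (cmod (F (m + k) x - ?G x))\<^sup>2 \<partial>M)"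
      by (simp add: norm_pi Linfty_diff Linfty_mult Linfty_rn F mn_Linfty)
    also have "\<dots> = (\<integral>x. wt (m + k) x * (u x - u ((r ^^ k) x))\<^sup>2 \<partial>M)"
    proof (rule Bochner_Integration.integral_cong[OF refl])
      fix x
      have "F (m + k) x - ?G x = complex_of_real (u x - u ((r ^^ k) x)) * mn (m + k) x"
        unfolding F_def mn_add by (simp add: algebra_simps)
      then show "(cmod (F (m + k) x - ?G x))\<^sup>2 = wt (m + k) x * (u x - u ((r ^^ k) x))\<^sup>2"
        by (simp only: norm_mult power_mult_distrib mn_norm norm_of_real power2_abs mult.commute)
    qed
    also have "\<dots> = I (m + k) - I m"
      unfolding I_def by (rule harmonic_increment[OF u fixed])
    finally show ?thesis .
  qed simp
  have inc: "incseq I"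
  proof (rule incseq_SucI)
    fix m
    have "0 \<le> I (m + 1) - I m" unfolding dist[symmetric] by (rule zero_le_power2)
    then show "I m \<le> I (Suc m)" by simp
  qed
  obtain C where "AE x in M. \<bar>u x\<bar> \<le> C" using u by (auto simp: ess_bounded_def)
  have bdd: "\<forall>n. I n \<le> C\<^sup>2 * measure M (space M)"
  proof
    fix n
    have "I n \<le> (\<integral>x. wt n x * C\<^sup>2 \<partial>M)"
      unfolding I_def
    proof (rule integral_mono_AE)
      show "AE x in M. wt n x * (u x)\<^sup>2 \<le> wt n x * C\<^sup>2"
        using \<open>AE x in M. \<bar>u x\<bar> \<le> C\<close>
        by eventually_elim (intro mult_left_mono wt_nonneg abs_le_square_iff[THEN iffD1], simp)
    qed (intro ess_bounded_integrable ess_bounded_mult wt_bounded ess_bounded_power u ess_bounded_const)+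
    also have "\<dots> = (\<integral>x. (T ^^ n) (\<lambda>_. C\<^sup>2) x \<partial>M)" by (rule integral_Tn[symmetric]) simp
    also have "\<dots> = (\<integral>x. C\<^sup>2 \<partial>M)"
      using Tn_const[of n "C\<^sup>2"]
      by (intro integral_cong_AE ess_bounded_measurable Tn_bounded ess_bounded_const)
    finally show "I n \<le> C\<^sup>2 * measure M (space M)" by (simp add: mult.commute)
  qed
  obtain L where "I \<longlonglongrightarrow> L" using incseq_convergent[OF inc bdd] by blast
  then have "Cauchy I" by (intro LIMSEQ_imp_Cauchy)
  have "Cauchy v"
  proof (rule metric_CauchyI)
    fix e :: real assume "e > 0"
    then obtain N where N: "\<And>m n. m \<ge> N \<Longrightarrow> n \<ge> N \<Longrightarrow> dist (I m) (I n) < e\<^sup>2"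
      using \<open>Cauchy I\<close> unfolding Cauchy_def by (metis zero_less_power)
    have *: "dist (v n) (v m) < e" if "N \<le> m" "m \<le> n" for m n
    proof -
      have "(norm (v n - v m))\<^sup>2 < e\<^sup>2"
        using dist[of m "n - m"] N[of n m] that by (auto simp: dist_real_def)
      then show ?thesis using \<open>e > 0\<close> by (simp add: dist_norm power2_less_imp_less)
    qed
    have "dist (v m) (v n) < e" if "N \<le> m" "N \<le> n" for m n
      using *[of m n] *[of n m] that by (metis dist_commute nat_le_linear)
    then show "\<exists>N. \<forall>m\<ge>N. \<forall>n\<ge>N. dist (v m) (v n) < e" by blast
  qed
  then obtain \<phi>' where lim: "v \<longlonglongrightarrow> \<phi>'" using Cauchy_convergent convergent_def by blast
  \<comment> \<open>\<open>F (Suc n)\<close> is \<open>F n\<close> times \<open>m0\<close> read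
    after \<open>n\<close> steps, and covariance turns that factor into \<open>\<pi> m0\<close>. In
    the limit this is the scaling equation.\<close>
  have step: "U (v (Suc n)) = \<pi> m0 (v n)" for n
  proof -
    have "(U ^^ n) (\<pi> m0 (v n)) = \<pi> (\<lambda>x. m0 ((r ^^ n) x)) (\<pi> (F n) \<phi>)"
      by (simp only: Un_pi[OF m0] v_def Un_Vn)
    also have "\<dots> = \<pi> (\<lambda>x. m0 ((r ^^ n) x) * F n x) \<phi>"
      by (simp only: pi_mult[OF Linfty_rn[OF m0] F])
    also have "(\<lambda>x. m0 ((r ^^ n) x) * F n x) = F (Suc n)"
      using mn_add[of 1 n] by (auto simp: F_def)
    finally have "(V ^^ n) ((U ^^ n) (\<pi> m0 (v n))) = (V ^^ n) (\<pi> (F (Suc n)) \<phi>)" by simp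
    then show ?thesis by (simp add: Vn_Un v_def U_V)
  qed
  have "(\<lambda>n. U (v (Suc n))) \<longlonglongrightarrow> U \<phi>'"
    by (intro bounded_linear.tendsto[OF U_linear] LIMSEQ_Suc lim)
  moreover have "(\<lambda>n. U (v (Suc n))) \<longlonglongrightarrow> \<pi> m0 \<phi>'"
    unfolding step by (intro bounded_linear.tendsto[OF pi_linear[OF m0]] lim)
  ultimately have sol: "U \<phi>' = \<pi> m0 \<phi>'" by (rule LIMSEQ_unique)
  have "\<phi>' \<noteq> c *\<^sub>C \<phi>" for c
  proof
    assume c: "\<phi>' = c *\<^sub>C \<phi>"
    \<comment> \<open>As \<open>u\<close> is real, its distance to \<open>c\<close> is at least that
      to \<open>Re c\<close>, and \<open>?w\<close> is again a real fixed point.\<close>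
    let ?w = "\<lambda>x. u x - Re c"
    have w: "ess_bounded M ?w" by (intro ess_bounded_diff u ess_bounded_const)
    have wf: "AE x in M. T ?w x = ?w x"
      using fixed T_one[of "Re c"] unfolding T_diff by eventually_elim simp
    have lower: "(\<integral>x. (?w x)\<^sup>2 \<partial>M) \<le> (norm (v n - c *\<^sub>C \<phi>))\<^sup>2" if "n \<ge> 1" for n
    proof -
      have n: "n > 0" using that by simp
      have "norm (v n - c *\<^sub>C \<phi>) = norm (\<pi> (F n) \<phi> - \<pi> (\<lambda>x. c * mn n x) \<phi>)"
        using norm_Un[of n "v n - c *\<^sub>C \<phi>"] unfolding Un_diff Un_scaleC Un_phi[OF n]
        by (simp only: v_def Un_Vn pi_scaleC[OF mn_Linfty])
      also have "\<dots> = norm (\<pi> (\<lambda>x. F n x - c * mn n x) \<phi>)"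
        by (subst pi_diff[OF F Linfty_mult[OF Linfty_const mn_Linfty]]) simp
      finally have "(norm (v n - c *\<^sub>C \<phi>))\<^sup>2 = (\<integral>x. (cmod (F n x - c * mn n x))\<^sup>2 \<partial>M)"
        by (simp add: norm_pi Linfty_diff Linfty_mult Linfty_const F mn_Linfty)
      also have "\<dots> \<ge> (\<integral>x. wt n x * (?w x)\<^sup>2 \<partial>M)"
      proof (rule integral_mono)
        show "integrable M (\<lambda>x. (cmod (F n x - c * mn n x))\<^sup>2)"
          by (intro ess_bounded_integrable ess_bounded_power Linfty_ess_bounded Linfty_diff
              Linfty_mult Linfty_const F mn_Linfty)
        fix x
        have "F n x - c * mn n x = (complex_of_real (u x) - c) * mn n x"
          by (simp add: F_def algebra_simps)
        then have "(cmod (F n x - c * mn n x))\<^sup>2 = wt n x * (cmod (complex_of_real (u x) - c))\<^sup>2"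
          by (simp only: norm_mult power_mult_distrib mn_norm mult.commute)
        also have "\<dots> \<ge> wt n x * (?w x)\<^sup>2"
          by (intro mult_left_mono wt_nonneg) (simp add: cmod_power2)
        finally show "wt n x * (?w x)\<^sup>2 \<le> (cmod (F n x - c * mn n x))\<^sup>2" .
      qed (intro ess_bounded_integrable ess_bounded_mult wt_bounded ess_bounded_power w)
      finally have *: "(\<integral>x. wt n x * (?w x)\<^sup>2 \<partial>M) \<le> (norm (v n - c *\<^sub>C \<phi>))\<^sup>2" .
      \<comment> \<open>With starting index 0, \<open>harmonic_increment\<close> shows that the
        integral weighted by \<open>wt n\<close> is at least the unweighted one, a lower bound
        independent of \<open>n\<close>.\<close>
      have "0 \<le> (\<integral>x. wt (0 + n) x * (?w x - ?w ((r ^^ n) x))\<^sup>2 \<partial>M)"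
        by (intro Bochner_Integration.integral_nonneg) (simp add: wt_nonneg)
      with * show ?thesis unfolding harmonic_increment[OF w wf] by simp
    qed
    have "(\<lambda>n. (norm (v n - c *\<^sub>C \<phi>))\<^sup>2) \<longlonglongrightarrow> (norm (\<phi>' - c *\<^sub>C \<phi>))\<^sup>2"
      by (intro tendsto_intros lim)
    then have "(\<integral>x. (?w x)\<^sup>2 \<partial>M) \<le> (norm (\<phi>' - c *\<^sub>C \<phi>))\<^sup>2"
      by (rule LIMSEQ_le_const) (use lower in blast)
    then have "(\<integral>x. (?w x)\<^sup>2 \<partial>M) \<le> 0" by (simp add: c)
    moreover have "(\<integral>x. (?w x)\<^sup>2 \<partial>M) \<ge> 0" by simp
    ultimately have "(\<integral>x. (?w x)\<^sup>2 \<partial>M) = 0" by linarith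
    then have "AE x in M. (?w x)\<^sup>2 = 0"
      using ess_bounded_integrable[OF ess_bounded_power[OF w, of 2]]
      by (subst (asm) integral_nonneg_eq_0_iff_AE) auto
    then have "AE x in M. u x = Re c" by eventually_elim simp
    with nc show False by blast
  qed
  with sol show ?thesis by blast
qed

end

text \<open>Balls of radius \<open>1 / Suc n\<close> shrink to their centre, so their measures tend
  to the mass of that point, which is 0. Compactness selects finitely many small balls.\<close>

lemma finite_cover_small_measure:
  fixes X :: "'a::metric_space set"
  assumes "finite_measure M" and X: "compact X"
    and sets: "sets M = sets (restrict_space borel X)"
    and null: "\<And>x. x \<in> X \<Longrightarrow> measure M {x} = 0" and \<epsilon>: "\<epsilon> > 0"
  shows "\<exists>F. finite F \<and> F \<subseteq> sets M \<and> space M \<subseteq> \<Union>F \<and> (\<forall>B\<in>F. measure M B < \<epsilon>)"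
proof -
  interpret finite_measure M by fact
  have space: "space M = X" using sets_eq_imp_space_eq[OF sets] by (simp add: space_restrict_space)
  have Bs: "B \<inter> X \<in> sets M" if "open B" for B
    using that compact_imp_closed[OF X] unfolding sets
    by (subst sets_restrict_space_iff) (auto intro: borel_open borel_closed)
  have "\<exists>d>0. measure M (ball x d \<inter> X) < \<epsilon>" if x: "x \<in> X" for x
  proof -
    let ?B = "\<lambda>n. ball x (1 / real (Suc n)) \<inter> X"
    have "(\<Inter>n. ?B n) = {x}"
    proof (intro equalityI subsetI)
      fix y assume y: "y \<in> (\<Inter>n. ?B n)"
      show "y \<in> {x}"
      proof (rule ccontr)
        assume "y \<notin> {x}"
        then have "dist x y > 0" by simp
        then obtain n where "1 / real (Suc n) < dist x y" using nat_approx_posE by blast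
        with y show False by (auto dest!: spec[of _ n])
      qed
    qed (use x in auto)
    moreover have "decseq ?B"
    proof (rule decseq_SucI)
      fix n
      have "1 / real (Suc (Suc n)) \<le> 1 / real (Suc n)" by (simp add: frac_le)
      then show "?B (Suc n) \<subseteq> ?B n" using subset_ball by blast
    qed
    ultimately have "(\<lambda>n. measure M (?B n)) \<longlonglongrightarrow> 0"
      using finite_Lim_measure_decseq[of ?B] Bs null[OF x] by auto
    then obtain n where "measure M (?B n) < \<epsilon>"
      using \<epsilon> by (metis (no_types, lifting) order_tendstoD(2) eventually_sequentially order_refl)
    then show ?thesis by (intro exI[of _ "1 / real (Suc n)"]) auto
  qed
  then obtain d where d: "\<And>x. x \<in> X \<Longrightarrow> d x > 0" "\<And>x. x \<in> X \<Longrightarrow> measure M (ball x (d x) \<inter> X) < \<epsilon>"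
    by metis
  obtain C where C: "C \<subseteq> X" "finite C" "X \<subseteq> (\<Union>c\<in>C. ball c (d c))"
    using compactE_image[OF X, of X "\<lambda>x. ball x (d x)"] d(1) by force
  show ?thesis
    using C d(2) Bs
    by (intro exI[of _ "(\<lambda>c. ball c (d c) \<inter> X) ` C"]) (auto simp: space)
qed

lemma strongly_invariant_real:
  assumes inv: "strongly_invariant r M" and f: "ess_bounded M f"
  shows "has_bochner_integral M (fibre_mean (space M) r f) (\<integral>x. f x \<partial>M)"
proof -
  have "has_bochner_integral M (fibre_mean (space M) r (\<lambda>x. complex_of_real (f x)))
      (\<integral>x. complex_of_real (f x) \<partial>M)"
    using inv Linfty_of_real[OF f] by (auto simp: strongly_invariant_def)
  moreover have "fibre_mean (space M) r (\<lambda>x. complex_of_real (f x))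
      = (\<lambda>x. complex_of_real (fibre_mean (space M) r f x))"
    by (auto simp: fibre_mean_def)
  ultimately show ?thesis
    using has_bochner_integral_bounded_linear[OF bounded_linear_Re] by fastforce
qed

theorem corollary5:
  fixes X :: "'a::metric_space set"
    and r :: "'a \<Rightarrow> 'a"
    and \<mu> :: "'a measure"
    and m0 :: "'a \<Rightarrow> complex"
  assumes "compact X"
    and "r \<in> measurable (restrict_space borel X) (restrict_space borel X)"
    and "r ` X = X"
    and "\<And>x. x \<in> X \<Longrightarrow> finite (r -` {x} \<inter> X)"
    and "sets \<mu> = sets (restrict_space borel X)"
    and "strongly_invariant r \<mu>"
    and "qmf_filter r \<mu> m0"
    and "ergodic r \<mu>"
    and "\<not> (AE x in \<mu>. cmod (m0 x) = 1)"
    and "emeasure \<mu> {x \<in> X. m0 x = 0} = 0"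
    and "integrable \<mu> (\<lambda>x. ln ((cmod (m0 x))\<^sup>2))"
  shows "(\<forall>(U :: 'h::complex_hilbert_space \<Rightarrow> 'h) \<pi> \<phi>.
            wavelet_representation r \<mu> m0 U \<pi> \<phi> \<longrightarrow>
            (\<exists>\<phi>'. U \<phi>' = \<pi> m0 \<phi>' \<and> (\<forall>c. \<phi>' \<noteq> c *\<^sub>C \<phi>))) \<and>
         (\<exists>f \<in> Linfty \<mu>. (AE x in \<mu>. transfer_operator X r m0 f x = f x) \<and>
            \<not> (\<exists>c. AE x in \<mu>. f x = c))"
proof -
  note sets = assms(5)
  have space: "space \<mu> = X"
    using sets_eq_imp_space_eq[OF sets] by (simp add: space_restrict_space)
  have fin: "finite_measure \<mu>" using assms(6) by (simp add: strongly_invariant_def)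
  have m0: "m0 \<in> Linfty \<mu>" using assms(7) by (simp add: qmf_filter_def)
  let ?D = "\<lambda>x. (cmod (m0 x))\<^sup>2"
  have transfer: "transfer \<mu> r ?D"
  proof (intro transfer.intro fibred.intro fibred_axioms.intro transfer_axioms.intro)
    show "r \<in> measurable \<mu> \<mu>"
      using assms(2) by (simp add: measurable_cong_sets[OF sets sets])
    show "ess_bounded \<mu> ?D" by (intro ess_bounded_power Linfty_ess_bounded m0)
    \<comment> \<open>\<open>emeasure\<close> is 0 by default on non-measurable sets, so
      measurability is established before the zero set is called null.\<close>
    have "{x \<in> X. m0 x = 0} \<in> sets \<mu>"
      using measurable_sets[of m0 \<mu> borel "{0}"] m0
      by (simp add: Linfty_def space vimage_def Int_def conj_commute)
    with assms(10) have "{x \<in> X. m0 x = 0} \<in> null_sets \<mu>" by auto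
    then show "AE x in \<mu>. 0 < ?D x" by (rule AE_I') (auto simp: space)
    show "AE x in \<mu>. fibre_mean (space \<mu>) r ?D x = 1"
      using assms(7) by (simp add: qmf_filter_def)
    show "has_bochner_integral \<mu> (fibre_mean (space \<mu>) r f) (\<integral>x. f x \<partial>\<mu>)"
      if "ess_bounded \<mu> f" for f
      by (rule strongly_invariant_real[OF assms(6) that])
  qed (use assms(3,4) fin in \<open>auto simp: space\<close>)
  interpret transfer \<mu> r ?D by (rule transfer)
  have ne: "\<not> (AE x in \<mu>. ?D x = 1)"
    proof
    assume "AE x in \<mu>. ?D x = 1"
    then have "AE x in \<mu>. cmod (m0 x) = 1"
    proof eventually_elim
      case (elim x)
      then show ?case by (rule power2_eq_imp_eq[of "cmod (m0 x)" 1, simplified])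
    qed
    with assms(9) show False by simp
  qed
  interpret transient \<mu> r ?D
    by unfold_locales (rule AE_summable_wt[OF assms(8) assms(11) ne])
  have "{x} \<in> sets \<mu>" if "x \<in> X" for x
    using that compact_imp_closed[OF assms(1)] unfolding sets
    by (subst sets_restrict_space_iff) auto
  then have null: "measure \<mu> {x} = 0" if "x \<in> X" for x
    using that no_point_mass by (simp add: space)
  \<comment> \<open>One real fixed point serves both claims: viewed as a complex function for the
    transfer operator, and through \<open>scaling_solution\<close> for every wavelet
    representation.\<close>
  obtain u where u: "ess_bounded \<mu> u" "AE x in \<mu>. T u x = u x" "\<not> (\<exists>c. AE x in \<mu>. u x = c)"
    using nonconstant_fixed_point[OF measure_space_pos[OF ne]
        finite_cover_small_measure[OF fin assms(1) sets null]] by blast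
  have "transfer_operator X r m0 (\<lambda>x. complex_of_real (u x)) x = complex_of_real (T u x)" for x
    by (simp add: transfer_operator_def T_def fibre_mean_def space)
  then have "AE x in \<mu>. transfer_operator X r m0 (\<lambda>x. complex_of_real (u x)) x = complex_of_real (u x)"
    using u(2) by simp
  moreover have "\<not> (\<exists>c. AE x in \<mu>. complex_of_real (u x) = c)"
  proof
    assume "\<exists>c. AE x in \<mu>. complex_of_real (u x) = c"
    then obtain c where "AE x in \<mu>. complex_of_real (u x) = c" ..
    then have "AE x in \<mu>. u x = Re c" by eventually_elim auto
    with u(3) show False by blast
  qed
  moreover have "\<exists>\<phi>'. U \<phi>' = \<pi> m0 \<phi>' \<and> (\<forall>c. \<phi>' \<noteq> c *\<^sub>C \<phi>)"
    if "wavelet_representation r \<mu> m0 U \<pi> \<phi>" for U :: "'h \<Rightarrow> 'h" and \<pi> \<phi>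
  proof -
    interpret wavelet \<mu> r ?D m0 U \<pi> \<phi>
      by unfold_locales (use m0 that in auto)
    show ?thesis by (rule scaling_solution[OF u])
  qed
  ultimately show ?thesis using Linfty_of_real[OF u(1)] by blast
qed

end
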